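(* Let $\prec$ be a well-order on $\mathbb{N}$. Suppose $I\Sigma_1(X)\vdash TI(\prec)$. Then there exists $h\in\omega$ such that Prover has a winning strategy for the game $\mathcal{G}_1(\prec,h)$.
   Context: **Arithmetic.** Formulas are in negation normal form over $\lnot,\land,\lor,\forall,\exists$; $\overline{\varphi}$ is the negation normal form of $\lnot\varphi$. $\mathcal{L}_{\mathbb{N}}$ is the language with a symbol for every function and predicate on $\mathbb{N}$ (so in particular for $=,\le,\prec$), and $\mathcal{L}_{\mathbb{N}}(X)=\mathcal{L}_{\mathbb{N}}\cup\{X\}$ with $X$ a fresh unary predicate; $X(x)$ is written $x\in X$. $\Delta_0$ (resp. $\Delta_0(X)$) is the class of bounded $\mathcal{L}_{\mathbb{N}}$- (resp. $\mathcal{L}_{\mathbb{N}}(X)$-) formulas. $p\Sigma_i$ is the class of $\mathcal{L}_{\mathbb{N}}$-formulas $\exists x_1\forall x_2\cdots\psi$ with exactly $i$ alternating unbounded quantifiers beginning with $\exists$, where $\psi$ is a maximal $\Delta_0$-subformula; $p\Sigma_i(X)$ is the same with $\Delta_0(X)$. $Th(\mathbb{N})$ is the set of all $\mathcal{L}_{\mathbb{N}}$-sentences in $\bigcup_i p\Sigma_i$ true in $\mathbb{N}$. $I\Sigma_k(X)$ is $Th(\mathbb{N})$ together with the scheme $(\varphi(0)\land\forall x(\varphi(x)\to\varphi(x+1)))\to\forall x\,\varphi(x)$ for $\varphi\in p\Sigma_k(X)$. $TI(\prec)$ is the sequent (finite set of formulas, read disjunctively) $$\{\forall y.\ \overline{y\in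 X},\ \ \exists x_0\forall x.\,(x_0\in X\land(\overline{x\in X}\lor\overline{x\prec x_0}))\},$$ and $I\Sigma_k(X)\vdash TI(\prec)$ means that the disjunction of these two sentences is provable in first-order logic from $I\Sigma_k(X)$. **Trees.** $\omega^{<\omega}$ is the set of finite sequences of natural numbers, $*$ is concatenation ($\sigma*k$ appends the number $k$), $\subseteq$ is the initial segment relation and $\subsetneq$ its proper version. A rooted tree is a nonempty subset of $\omega^{<\omega}$ closed under initial segments; $\sigma*k$ is a child of its parent $\sigma$; leaves are nodes without children; the height of a node is its length and the height of a finite tree is the maximum height of its nodes. A comb of height $\le h$ is a finite rooted tree $T$ of height $\le h$ such that the children of each non-leaf $\sigma$ are the $\sigma*i$ with $i$ in a nonempty interval of consecutive natural numbers, and, with $c(T)$ denoting the lexicographically least (leftmost) leaf, every parent of a leaf is a proper initial segment of $c(T)$. A finite partial predicate is a function from a finite subset of $\mathbb{N}$ to $\{0,1\}$; $\mathcal{R}$ is the set of these. **The game $\mathcal{G}_1(\prec,h)$** ($h\in\omega$), played by Prover and Delayer. A possible position is a pair $(T,\rho)$ with $T$ a comb of height $\le h$ and $\rho\in\mathcal{R}$. Delayer chooses $m_0\in\mathbb{N}$ and the initial position is $(\{\emptyset\},\{m_0\mapsto1\})$. At position $(T,\rho)$: (a) Prover plays a finite set $Q\subseteq\mathbb{N}$. (b) Delayer plays $\rho'\in\mathcal{R}$ with $Q\subseteq\mathrm{dom}(\rho')$ such that for every $q\in Q$ with $\rho'(q)=1$ there is $p\prec q$ with $\rho'(p)=1$.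 If $\rho\cup\rho'$ is not a function, the play ends and Prover wins. Otherwise: (c) Prover plays $\langle o,b\rangle$ with either $o=0$ and $b\in\omega$, or $o=1$ and $b\in\omega^{<\omega}$ with $b\subsetneq c(T)$. (d) If $o=0$, let $T'=T\cup\{c(T)*i\mid 0\le i\le b\}$; if $T'$ has height $>h$ the game ends and Prover loses, otherwise the next position is $(T',\rho\cup\rho')$. If $o=1$, write $c(T)=b*k*\sigma$ with $k\in\omega$; if $b*(k+1)\notin T$ the game ends and Prover loses, otherwise the next position is $(T\setminus\{b*k*\tau\mid\tau\in\omega^{<\omega}\},\rho\cup\rho')$. Strategies may depend on the whole history of the play; a winning strategy is one that wins against every strategy of the opponent. *)

theory Defs
  imports Main "HOL-Library.Sublist"
begin

section \<open>Arithmetic\<close>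

text \<open>
  A symbol is an arity together with the function or predicate it denotes. Lists of the wrong
  length are sent to a default value (\<open>wf_fsym\<close>, \<open>wf_psym\<close>), so that there is exactly one symbol
  for each function and each predicate on the natural numbers.
\<close>

type_synonym fsym = "nat \<times> (nat list \<Rightarrow> nat)"
type_synonym psym = "nat \<times> (nat list \<Rightarrow> bool)"

definition wf_fsym :: "fsym \<Rightarrow> bool" where
  "wf_fsym f \<longleftrightarrow> (\<forall>xs. length xs \<noteq> fst f \<longrightarrow> snd f xs = 0)"

definition wf_psym :: "psym \<Rightarrow> bool" where
  "wf_psym p \<longleftrightarrow> (\<forall>xs. length xs \<noteq> fst p \<longrightarrow> \<not> snd p xs)"

definition const_sym :: "nat \<Rightarrow> fsym" where
  "const_sym n = (0, \<lambda>xs. if xs = [] then n else 0)"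

definition binary_fsym :: "(nat \<Rightarrow> nat \<Rightarrow> nat) \<Rightarrow> fsym" where
  "binary_fsym f = (2, \<lambda>xs. if length xs = 2 then f (xs ! 0) (xs ! 1) else 0)"

definition binary_psym :: "(nat \<Rightarrow> nat \<Rightarrow> bool) \<Rightarrow> psym" where
  "binary_psym p = (2, \<lambda>xs. length xs = 2 \<and> p (xs ! 0) (xs ! 1))"

text \<open>Variables are de Bruijn indices; formulas are in negation normal form.\<close>

datatype tm = Var nat | Fun fsym "tm list"

datatype fm =
    Atom psym "tm list"
  | NAtom psym "tm list"
  | InX tm
  | NotInX tm
  | And fm fm
  | Or fm fm
  | Forall fm
  | Exists fm

fun wf_tm :: "tm \<Rightarrow> bool" where
  "wf_tm (Var n) = True"
| "wf_tm (Fun f ts) = (wf_fsym f \<and> length ts = fst f \<and> (\<forall>t\<in>set ts. wf_tm t))"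

fun wf_fm :: "fm \<Rightarrow> bool" where
  "wf_fm (Atom p ts) = (wf_psym p \<and> length ts = fst p \<and> (\<forall>t\<in>set ts. wf_tm t))"
| "wf_fm (NAtom p ts) = (wf_psym p \<and> length ts = fst p \<and> (\<forall>t\<in>set ts. wf_tm t))"
| "wf_fm (InX t) = wf_tm t"
| "wf_fm (NotInX t) = wf_tm t"
| "wf_fm (And A B) = (wf_fm A \<and> wf_fm B)"
| "wf_fm (Or A B) = (wf_fm A \<and> wf_fm B)"
| "wf_fm (Forall A) = wf_fm A"
| "wf_fm (Exists A) = wf_fm A"

fun neg :: "fm \<Rightarrow> fm" where
  "neg (Atom p ts) = NAtom p ts"
| "neg (NAtom p ts) = Atom p ts"
| "neg (InX t) = NotInX t"
| "neg (NotInX t) = InX t"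
| "neg (And A B) = Or (neg A) (neg B)"
| "neg (Or A B) = And (neg A) (neg B)"
| "neg (Forall A) = Exists (neg A)"
| "neg (Exists A) = Forall (neg A)"

definition imp :: "fm \<Rightarrow> fm \<Rightarrow> fm" where
  "imp A B = Or (neg A) B"

fun X_free :: "fm \<Rightarrow> bool" where
  "X_free (Atom p ts) = True"
| "X_free (NAtom p ts) = True"
| "X_free (InX t) = False"
| "X_free (NotInX t) = False"
| "X_free (And A B) = (X_free A \<and> X_free B)"
| "X_free (Or A B) = (X_free A \<and> X_free B)"
| "X_free (Forall A) = X_free A"
| "X_free (Exists A) = X_free A"

fun literal :: "fm \<Rightarrow> bool" where
  "literal (And A B) = False"
| "literal (Or A B) = False"
| "literal (Forall A) = False"
| "literal (Exists A) = False"
| "literal _ = True"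

fun fv_tm :: "tm \<Rightarrow> nat set" where
  "fv_tm (Var n) = {n}"
| "fv_tm (Fun f ts) = (\<Union>t\<in>set ts. fv_tm t)"

fun fv :: "fm \<Rightarrow> nat set" where
  "fv (Atom p ts) = (\<Union>t\<in>set ts. fv_tm t)"
| "fv (NAtom p ts) = (\<Union>t\<in>set ts. fv_tm t)"
| "fv (InX t) = fv_tm t"
| "fv (NotInX t) = fv_tm t"
| "fv (And A B) = fv A \<union> fv B"
| "fv (Or A B) = fv A \<union> fv B"
| "fv (Forall A) = {n. Suc n \<in> fv A}"
| "fv (Exists A) = {n. Suc n \<in> fv A}"

fun subst_tm :: "(nat \<Rightarrow> tm) \<Rightarrow> tm \<Rightarrow> tm" where
  "subst_tm s (Var n) = s n"
| "subst_tm s (Fun f ts) = Fun f (map (subst_tm s) ts)"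

definition lift_tm :: "tm \<Rightarrow> tm" where
  "lift_tm = subst_tm (\<lambda>n. Var (Suc n))"

definition under_binder :: "(nat \<Rightarrow> tm) \<Rightarrow> nat \<Rightarrow> tm" where
  "under_binder s = case_nat (Var 0) (\<lambda>n. lift_tm (s n))"

fun subst :: "(nat \<Rightarrow> tm) \<Rightarrow> fm \<Rightarrow> fm" where
  "subst s (Atom p ts) = Atom p (map (subst_tm s) ts)"
| "subst s (NAtom p ts) = NAtom p (map (subst_tm s) ts)"
| "subst s (InX t) = InX (subst_tm s t)"
| "subst s (NotInX t) = NotInX (subst_tm s t)"
| "subst s (And A B) = And (subst s A) (subst s B)"
| "subst s (Or A B) = Or (subst s A) (subst s B)"
| "subst s (Forall A) = Forall (subst (under_binder s) A)"
| "subst s (Exists A) = Exists (subst (under_binder s) A)"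

definition lift :: "fm \<Rightarrow> fm" where
  "lift = subst (\<lambda>n. Var (Suc n))"

text \<open>\<open>inst A t\<close> removes the outermost binder: index 0 becomes \<open>t\<close>, the others go down by one.\<close>

definition inst :: "fm \<Rightarrow> tm \<Rightarrow> fm" where
  "inst A t = subst (case_nat t Var) A"

abbreviation eq_sym :: psym where "eq_sym \<equiv> binary_psym (=)"
abbreviation le_sym :: psym where "le_sym \<equiv> binary_psym (\<le>)"

definition zero_tm :: tm where
  "zero_tm = Fun (const_sym 0) []"

definition succ_tm :: "tm \<Rightarrow> tm" where
  "succ_tm t = Fun (binary_fsym (+)) [t, Fun (const_sym 1) []]"

subsection \<open>Truth in the standard model\<close>

fun eval_tm :: "(nat \<Rightarrow> nat) \<Rightarrow> tm \<Rightarrow> nat" where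
  "eval_tm e (Var n) = e n"
| "eval_tm e (Fun f ts) = snd f (map (eval_tm e) ts)"

fun holds :: "nat set \<Rightarrow> (nat \<Rightarrow> nat) \<Rightarrow> fm \<Rightarrow> bool" where
  "holds X e (Atom p ts) = snd p (map (eval_tm e) ts)"
| "holds X e (NAtom p ts) = (\<not> snd p (map (eval_tm e) ts))"
| "holds X e (InX t) = (eval_tm e t \<in> X)"
| "holds X e (NotInX t) = (eval_tm e t \<notin> X)"
| "holds X e (And A B) = (holds X e A \<and> holds X e B)"
| "holds X e (Or A B) = (holds X e A \<or> holds X e B)"
| "holds X e (Forall A) = (\<forall>n. holds X (case_nat n e) A)"
| "holds X e (Exists A) = (\<exists>n. holds X (case_nat n e) A)"

subsection \<open>Formula classes\<close>

text \<open>
  The bounded quantifiers are \<open>\<forall>x (\<not> x \<le> t \<or> A)\<close> and \<open>\<exists>x (x \<le> t \<and> A)\<close>, where \<open>x\<close> does not occur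
  in \<open>t\<close>; the latter is what \<open>lift_tm\<close> expresses.
\<close>

inductive Delta0_X :: "fm \<Rightarrow> bool" where
  "literal A \<Longrightarrow> wf_fm A \<Longrightarrow> Delta0_X A"
| "Delta0_X A \<Longrightarrow> Delta0_X B \<Longrightarrow> Delta0_X (And A B)"
| "Delta0_X A \<Longrightarrow> Delta0_X B \<Longrightarrow> Delta0_X (Or A B)"
| "Delta0_X A \<Longrightarrow> wf_tm t \<Longrightarrow> Delta0_X (Forall (Or (NAtom le_sym [Var 0, lift_tm t]) A))"
| "Delta0_X A \<Longrightarrow> wf_tm t \<Longrightarrow> Delta0_X (Exists (And (Atom le_sym [Var 0, lift_tm t]) A))"

text \<open>
  The side conditions \<open>\<not> Delta0_X (Exists A)\<close> and \<open>\<not> Delta0_X (Forall A)\<close> say that the quantifiers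
  in the prefix are unbounded, that is, that the matrix is a maximal bounded subformula.
\<close>

inductive pSigma_X :: "nat \<Rightarrow> fm \<Rightarrow> bool" and pPi_X :: "nat \<Rightarrow> fm \<Rightarrow> bool" where
  "Delta0_X A \<Longrightarrow> pSigma_X 0 A"
| "Delta0_X A \<Longrightarrow> pPi_X 0 A"
| "pPi_X i A \<Longrightarrow> \<not> Delta0_X (Exists A) \<Longrightarrow> pSigma_X (Suc i) (Exists A)"
| "pSigma_X i A \<Longrightarrow> \<not> Delta0_X (Forall A) \<Longrightarrow> pPi_X (Suc i) (Forall A)"

definition pSigma :: "nat \<Rightarrow> fm \<Rightarrow> bool" where
  "pSigma i A \<longleftrightarrow> pSigma_X i A \<and> X_free A"

subsection \<open>Theories and provability\<close>

definition Th_N :: "fm set" where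
  "Th_N = {A. fv A = {} \<and> (\<exists>i. pSigma i A) \<and> (\<forall>X e. holds X e A)}"

text \<open>The induction variable is index 0; all other free variables of \<open>A\<close> are parameters.\<close>

definition induction_axiom :: "fm \<Rightarrow> fm" where
  "induction_axiom A =
     imp (And (inst A zero_tm)
              (Forall (imp A (subst (case_nat (succ_tm (Var 0)) (\<lambda>n. Var (Suc n))) A))))
         (Forall A)"

definition ISigma_X :: "nat \<Rightarrow> fm set" where
  "ISigma_X k = Th_N \<union> {induction_axiom A | A. pSigma_X k A}"

text \<open>
  First-order logic with equality in Tait's one-sided sequent calculus: sequents are finite sets
  of formulas, read disjunctively. Axioms of \<open>T\<close> may have free variables (the parameters of
  induction); rule \<open>forall_rule\<close>, whose eigenvariable condition is the lifting of the side formulas, makes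
  them equivalent to their universal closures.
\<close>

definition sequent :: "fm set \<Rightarrow> bool" where
  "sequent \<Gamma> \<longleftrightarrow> finite \<Gamma> \<and> (\<forall>A\<in>\<Gamma>. wf_fm A)"

inductive derivable :: "fm set \<Rightarrow> fm set \<Rightarrow> bool" (infix "\<turnstile>" 50) for T :: "fm set" where
  identity_rule: "sequent \<Gamma> \<Longrightarrow> A \<in> \<Gamma> \<Longrightarrow> neg A \<in> \<Gamma> \<Longrightarrow> T \<turnstile> \<Gamma>"
| axiom_rule: "sequent \<Gamma> \<Longrightarrow> A \<in> T \<Longrightarrow> A \<in> \<Gamma> \<Longrightarrow> T \<turnstile> \<Gamma>"
| eq_refl_rule: "sequent \<Gamma> \<Longrightarrow> Atom eq_sym [t, t] \<in> \<Gamma> \<Longrightarrow> T \<turnstile> \<Gamma>"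
| eq_subst_rule: "sequent \<Gamma> \<Longrightarrow> literal A \<Longrightarrow> NAtom eq_sym [t, u] \<in> \<Gamma> \<Longrightarrow> neg (inst A t) \<in> \<Gamma> \<Longrightarrow>
    inst A u \<in> \<Gamma> \<Longrightarrow> T \<turnstile> \<Gamma>"
| and_rule: "T \<turnstile> insert A \<Gamma> \<Longrightarrow> T \<turnstile> insert B \<Gamma> \<Longrightarrow> T \<turnstile> insert (And A B) \<Gamma>"
| or_rule: "T \<turnstile> insert A (insert B \<Gamma>) \<Longrightarrow> T \<turnstile> insert (Or A B) \<Gamma>"
| forall_rule: "T \<turnstile> insert A (lift ` \<Gamma>) \<Longrightarrow> T \<turnstile> insert (Forall A) \<Gamma>"
| exists_rule: "T \<turnstile> insert (inst A t) \<Gamma> \<Longrightarrow> wf_tm t \<Longrightarrow> T \<turnstile> insert (Exists A) \<Gamma>"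
| cut_rule: "T \<turnstile> insert A \<Gamma> \<Longrightarrow> T \<turnstile> insert (neg A) \<Gamma> \<Longrightarrow> T \<turnstile> \<Gamma>"

definition provable :: "fm set \<Rightarrow> fm \<Rightarrow> bool" where
  "provable T A \<longleftrightarrow> T \<turnstile> {A}"

text \<open>In the second disjunct \<open>x\<^sub>0\<close> is index 1 and \<open>x\<close> is index 0.\<close>

definition TI :: "(nat \<Rightarrow> nat \<Rightarrow> bool) \<Rightarrow> fm" where
  "TI prec =
     Or (Forall (NotInX (Var 0)))
        (Exists (Forall (And (InX (Var 1))
           (Or (NotInX (Var 0)) (NAtom (binary_psym prec) [Var 0, Var 1])))))"

section \<open>Trees\<close>

type_synonym node = "nat list"

definition rooted_tree :: "node set \<Rightarrow> bool" where
  "rooted_tree T \<longleftrightarrow> T \<noteq> {} \<and> (\<forall>\<sigma>\<in>T. \<forall>\<tau>. prefix \<tau> \<sigma> \<longrightarrow> \<tau> \<in> T)"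

definition leaf :: "node set \<Rightarrow> node \<Rightarrow> bool" where
  "leaf T \<sigma> \<longleftrightarrow> \<sigma> \<in> T \<and> (\<forall>k. \<sigma> @ [k] \<notin> T)"

definition height :: "node set \<Rightarrow> nat" where
  "height T = Max (length ` T)"

definition leftmost_leaf :: "node set \<Rightarrow> node" where
  "leftmost_leaf T = (THE \<sigma>. leaf T \<sigma> \<and> (\<forall>\<tau>. leaf T \<tau> \<longrightarrow> lexordp_eq \<sigma> \<tau>))"

definition comb :: "nat \<Rightarrow> node set \<Rightarrow> bool" where
  "comb h T \<longleftrightarrow> finite T \<and> rooted_tree T \<and> height T \<le> h \<and>
     (\<forall>\<sigma>\<in>T. \<not> leaf T \<sigma> \<longrightarrow> (\<exists>i j. i \<le> j \<and> {k. \<sigma> @ [k] \<in> T} = {i..j})) \<and>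
     (\<forall>\<sigma> k. leaf T (\<sigma> @ [k]) \<longrightarrow> strict_prefix \<sigma> (leftmost_leaf T))"

section \<open>The game\<close>

text \<open>A finite partial predicate is a finite map into \<open>bool\<close>; \<open>True\<close> stands for 1.\<close>

type_synonym partial_predicate = "nat \<rightharpoonup> bool"

definition possible_position :: "nat \<Rightarrow> node set \<Rightarrow> partial_predicate \<Rightarrow> bool" where
  "possible_position h T \<rho> \<longleftrightarrow> comb h T \<and> finite (dom \<rho>)"

definition compatible :: "partial_predicate \<Rightarrow> partial_predicate \<Rightarrow> bool" where
  "compatible \<rho> \<rho>' \<longleftrightarrow> (\<forall>x \<in> dom \<rho> \<inter> dom \<rho>'. \<rho> x = \<rho>' x)"

text \<open>\<open>Extend b\<close> and \<open>Backtrack b\<close> are the moves \<open>\<langle>0,b\<rangle>\<close> and \<open>\<langle>1,b\<rangle>\<close>.\<close>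

datatype move =
    Choose nat
  | Query "nat set"
  | Reply partial_predicate
  | Extend nat
  | Backtrack node

text \<open>
  \<open>At T \<rho>\<close> is the position \<open>(T, \<rho>)\<close>; within a round, \<open>Queried T \<rho> Q\<close> and \<open>Replied T \<rho>'\<close> are the
  situations after (a) and (b). In the latter the map is already the union of \<open>\<rho>\<close> and the reply.
\<close>

datatype state =
    Start
  | At "node set" partial_predicate
  | Queried "node set" partial_predicate "nat set"
  | Replied "node set" partial_predicate
  | Prover_Wins
  | Delayer_Wins

fun prover_to_move :: "state \<Rightarrow> bool" where
  "prover_to_move (At T \<rho>) = True"
| "prover_to_move (Replied T \<rho>) = True"
| "prover_to_move _ = False"

fun delayer_to_move :: "state \<Rightarrow> bool" where
  "delayer_to_move Start = True"
| "delayer_to_move (Queried T \<rho> Q) = True"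
| "delayer_to_move _ = False"

fun legal :: "(nat \<Rightarrow> nat \<Rightarrow> bool) \<Rightarrow> state \<Rightarrow> move \<Rightarrow> bool" where
  "legal prec Start (Choose m) = True"
| "legal prec (At T \<rho>) (Query Q) = finite Q"
| "legal prec (Queried T \<rho> Q) (Reply \<rho>') =
     (finite (dom \<rho>') \<and> Q \<subseteq> dom \<rho>' \<and>
      (\<forall>q\<in>Q. \<rho>' q = Some True \<longrightarrow> (\<exists>p. prec p q \<and> \<rho>' p = Some True)))"
| "legal prec (Replied T \<rho>) (Extend b) = True"
| "legal prec (Replied T \<rho>) (Backtrack b) = strict_prefix b (leftmost_leaf T)"
| "legal prec _ _ = False"

text \<open>
  In the last equation, \<open>k\<close> is the entry with \<open>leftmost_leaf T = b @ [k] @ \<sigma>\<close>. Illegal moves leave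
  the state unchanged; they never occur in a play.
\<close>

fun next_state :: "nat \<Rightarrow> state \<Rightarrow> move \<Rightarrow> state" where
  "next_state h Start (Choose m) = At {[]} [m \<mapsto> True]"
| "next_state h (At T \<rho>) (Query Q) = Queried T \<rho> Q"
| "next_state h (Queried T \<rho> Q) (Reply \<rho>') =
     (if compatible \<rho> \<rho>' then Replied T (\<rho> ++ \<rho>') else Prover_Wins)"
| "next_state h (Replied T \<rho>) (Extend b) =
     (let T' = T \<union> {leftmost_leaf T @ [i] | i. i \<le> b}
      in if height T' > h then Delayer_Wins else At T' \<rho>)"
| "next_state h (Replied T \<rho>) (Backtrack b) =
     (let k = leftmost_leaf T ! length b
      in if b @ [k + 1] \<notin> T then Delayer_Wins else At (T - {b @ [k] @ \<tau> | \<tau>. True}) \<rho>)"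
| "next_state h s _ = s"

definition state_after :: "nat \<Rightarrow> move list \<Rightarrow> state" where
  "state_after h ms = foldl (next_state h) Start ms"

definition legal_history :: "(nat \<Rightarrow> nat \<Rightarrow> bool) \<Rightarrow> nat \<Rightarrow> move list \<Rightarrow> bool" where
  "legal_history prec h ms \<longleftrightarrow>
     (\<forall>i<length ms. legal prec (state_after h (take i ms)) (ms ! i))"

type_synonym strategy = "move list \<Rightarrow> move"

definition prover_strategy :: "(nat \<Rightarrow> nat \<Rightarrow> bool) \<Rightarrow> nat \<Rightarrow> strategy \<Rightarrow> bool" where
  "prover_strategy prec h S \<longleftrightarrow>
     (\<forall>ms. legal_history prec h ms \<and> prover_to_move (state_after h ms) \<longrightarrow>
        legal prec (state_after h ms) (S ms))"

definition delayer_strategy :: "(nat \<Rightarrow> nat \<Rightarrow> bool) \<Rightarrow> nat \<Rightarrow> strategy \<Rightarrow> bool" where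
  "delayer_strategy prec h D \<longleftrightarrow>
     (\<forall>ms. legal_history prec h ms \<and> delayer_to_move (state_after h ms) \<longrightarrow>
        legal prec (state_after h ms) (D ms))"

text \<open>The first \<open>n\<close> moves (fewer, if the game is over earlier) when \<open>S\<close> plays against \<open>D\<close>.\<close>

fun play :: "nat \<Rightarrow> strategy \<Rightarrow> strategy \<Rightarrow> nat \<Rightarrow> move list" where
  "play h S D 0 = []"
| "play h S D (Suc n) =
     (let ms = play h S D n in
      if prover_to_move (state_after h ms) then ms @ [S ms]
      else if delayer_to_move (state_after h ms) then ms @ [D ms]
      else ms)"

definition prover_winning_strategy :: "(nat \<Rightarrow> nat \<Rightarrow> bool) \<Rightarrow> nat \<Rightarrow> strategy \<Rightarrow> bool" where
  "prover_winning_strategy prec h S \<longleftrightarrow>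
     prover_strategy prec h S \<and>
     (\<forall>D. delayer_strategy prec h D \<longrightarrow>
        (\<exists>n. state_after h (play h S D n) = Prover_Wins))"

subsection \<open>The moves preserve possible positions\<close>

text \<open>All positions that occur in the game are possible positions, so no rule has to demand it.\<close>

lemma leftmost_leaf_eqI:
  assumes "leaf T c" "\<And>\<tau>. leaf T \<tau> \<Longrightarrow> lexordp_eq c \<tau>"
  shows "leftmost_leaf T = c"
  unfolding leftmost_leaf_def
  by (rule the_equality) (use assms in \<open>auto intro: lexordp_eq_antisym\<close>)

lemma finite_lexordp_least:
  fixes S :: "node set"
  assumes "finite S" "S \<noteq> {}"
  shows "\<exists>c\<in>S. \<forall>\<tau>\<in>S. lexordp_eq c \<tau>"
  using assms
proof (induction rule: finite_ne_induct)
  case (singleton x)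
  then show ?case by (auto intro: lexordp_eq_refl)
next
  case (insert x F)
  then obtain c where c: "c \<in> F" "\<forall>\<tau>\<in>F. lexordp_eq c \<tau>" by blast
  show ?case
  proof (cases "lexordp_eq c x")
    case True
    then show ?thesis using c by auto
  next
    case False
    then have "lexordp_eq x c" using lexordp_eq_linear by blast
    then show ?thesis using c by (auto intro: lexordp_eq_refl lexordp_eq_trans)
  qed
qed

lemma leaf_above:
  assumes "finite T" "\<sigma> \<in> T"
  obtains \<tau> where "leaf T \<tau>" "prefix \<sigma> \<tau>"
proof -
  let ?S = "{\<tau>\<in>T. prefix \<sigma> \<tau>}"
  have "finite ?S" "\<sigma> \<in> ?S" using assms by auto
  then have "finite (length ` ?S)" "length ` ?S \<noteq> {}" by blast+
  then have "Max (length ` ?S) \<in> length ` ?S" "\<forall>\<upsilon>\<in>?S. length \<upsilon> \<le> Max (length ` ?S)"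
    using Max_in[of "length ` ?S"] Max_ge[of "length ` ?S"] by blast+
  then obtain \<tau> where \<tau>: "\<tau> \<in> ?S" "\<forall>\<upsilon>\<in>?S. length \<upsilon> \<le> length \<tau>" by force
  have "leaf T \<tau>"
    unfolding leaf_def
  proof (intro conjI allI notI)
    show "\<tau> \<in> T" using \<tau> by simp
    fix k assume "\<tau> @ [k] \<in> T"
    then have "\<tau> @ [k] \<in> ?S" using \<tau>(1) by (auto simp: prefix_def)
    then show False using \<tau>(2) by (metis length_append_singleton Suc_n_not_le_n)
  qed
  then show ?thesis using that \<tau>(1) by blast
qed

lemma leftmost_leaf:
  assumes "finite T" "rooted_tree T"
  shows "leaf T (leftmost_leaf T)" "leaf T \<tau> \<Longrightarrow> lexordp_eq (leftmost_leaf T) \<tau>"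
proof -
  obtain \<sigma> where "\<sigma> \<in> T" using assms(2) by (auto simp: rooted_tree_def)
  then have "Collect (leaf T) \<noteq> {}" using leaf_above[OF assms(1)] by blast
  moreover have "finite (Collect (leaf T))"
    using assms(1) by (rule rev_finite_subset) (auto simp: leaf_def)
  ultimately obtain c where c: "leaf T c" "\<And>\<tau>. leaf T \<tau> \<Longrightarrow> lexordp_eq c \<tau>"
    using finite_lexordp_least[of "Collect (leaf T)"] by auto
  then show "leaf T (leftmost_leaf T)" "leaf T \<tau> \<Longrightarrow> lexordp_eq (leftmost_leaf T) \<tau>"
    using leftmost_leaf_eqI[OF c] by auto
qed

lemma prefix_leaf:
  assumes "rooted_tree T" "leaf T c" "\<tau> \<in> T" "prefix c \<tau>"
  shows "\<tau> = c"
proof -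
  obtain \<upsilon> where \<upsilon>: "\<tau> = c @ \<upsilon>" using assms(4) by (auto simp: prefix_def)
  show ?thesis
  proof (cases \<upsilon>)
    case (Cons k \<upsilon>')
    then have "prefix (c @ [k]) \<tau>" using \<upsilon> by (simp add: prefix_def)
    then show ?thesis using assms(1-3) by (auto simp: rooted_tree_def leaf_def)
  qed (use \<upsilon> in simp)
qed

lemma lexordp_eq_appendI:
  fixes c :: node
  shows "lexordp_eq c \<tau> \<Longrightarrow> \<not> prefix c \<tau> \<Longrightarrow> lexordp_eq (c @ x) \<tau>"
  by (induction rule: lexordp_eq.induct) auto

lemma lexordp_eq_next:
  fixes b :: node
  shows "lexordp_eq (b @ k # \<sigma>) \<tau> \<Longrightarrow> \<not> prefix (b @ [k]) \<tau> \<Longrightarrow> lexordp_eq (b @ [k + 1]) \<tau>"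
proof (induction b arbitrary: \<tau>)
  case Nil
  then show ?case by (cases \<tau>) auto
next
  case (Cons a b)
  then show ?case by (cases \<tau>) auto
qed

lemma height_le: "finite T \<Longrightarrow> T \<noteq> {} \<Longrightarrow> height T \<le> h \<longleftrightarrow> (\<forall>\<sigma>\<in>T. length \<sigma> \<le> h)"
  by (auto simp: height_def)

lemma comb_root: "comb h {[]}"
proof -
  have "leaf {[]} ([]::node)" "rooted_tree {[]}" by (auto simp: leaf_def rooted_tree_def)
  then show ?thesis by (auto simp: comb_def height_def leaf_def)
qed

lemma comb_extend:
  assumes T: "comb h T" and T': "T' = T \<union> {leftmost_leaf T @ [i] | i. i \<le> b}" and h: "height T' \<le> h"
  shows "comb h T'"
proof -
  define c where "c = leftmost_leaf T"
  have fin: "finite T" and tree: "rooted_tree T"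
    and iv: "\<And>\<sigma>. \<sigma> \<in> T \<Longrightarrow> \<not> leaf T \<sigma> \<Longrightarrow> \<exists>i j. i \<le> j \<and> {k. \<sigma> @ [k] \<in> T} = {i..j}"
    and par: "\<And>\<sigma> k. leaf T (\<sigma> @ [k]) \<Longrightarrow> strict_prefix \<sigma> c"
    using T by (auto simp: comb_def c_def)
  have c: "leaf T c" "\<And>\<tau>. leaf T \<tau> \<Longrightarrow> lexordp_eq c \<tau>"
    using leftmost_leaf[OF fin tree] by (auto simp: c_def)
  have T': "T' = T \<union> (\<lambda>i. c @ [i]) ` {..b}" using T' by (auto simp: c_def)
  have fin': "finite T'" using fin T' by simp
  have new: "c @ i # \<tau> \<notin> T" for i \<tau>
    using prefix_leaf[OF tree c(1), of "c @ i # \<tau>"] by auto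
  have tree': "rooted_tree T'"
    using tree c(1) unfolding T' rooted_tree_def leaf_def by (auto simp: prefix_snoc)
  have leaves: "leaf T' \<tau> \<longleftrightarrow> leaf T \<tau> \<and> \<tau> \<noteq> c \<or> (\<exists>i\<le>b. \<tau> = c @ [i])" for \<tau>
    using new c(1) unfolding leaf_def T' by auto
  have c': "leftmost_leaf T' = c @ [0]"
  proof (rule leftmost_leaf_eqI)
    show "leaf T' (c @ [0])" by (simp add: leaves)
    fix \<tau> assume "leaf T' \<tau>"
    then consider "leaf T \<tau>" "\<tau> \<noteq> c" | i where "\<tau> = c @ [i]" by (auto simp: leaves)
    then show "lexordp_eq (c @ [0]) \<tau>"
    proof cases
      case 1
      then have "\<not> prefix c \<tau>" using prefix_leaf[OF tree c(1)] by (auto simp: leaf_def)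
      then show ?thesis using c(2) 1 lexordp_eq_appendI by blast
    next
      case 2
      have "lexordp_eq (c @ [0]) (c @ [i])" by (induction c) auto
      with 2 show ?thesis by simp
    qed
  qed
  have "\<exists>i j. i \<le> j \<and> {k. \<sigma> @ [k] \<in> T'} = {i..j}" if "\<sigma> \<in> T'" "\<not> leaf T' \<sigma>" for \<sigma>
  proof (cases "\<sigma> = c")
    case True
    have "{k. c @ [k] \<in> T'} = {0..b}" using new by (auto simp: T')
    then show ?thesis using True by blast
  next
    case False
    then have "{k. \<sigma> @ [k] \<in> T'} = {k. \<sigma> @ [k] \<in> T}" by (auto simp: T')
    moreover have "\<sigma> \<in> T" "\<not> leaf T \<sigma>" using that False leaves[of \<sigma>] by (auto simp: T')
    ultimately show ?thesis using iv by metis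
  qed
  moreover have "strict_prefix \<sigma> (c @ [0])" if "leaf T' (\<sigma> @ [k])" for \<sigma> k
    using that par[of \<sigma> k] by (auto simp: leaves strict_prefix_def prefix_def)
  ultimately show ?thesis using fin' tree' h by (simp add: comb_def c')
qed

lemma comb_backtrack:
  assumes T: "comb h T" and b: "strict_prefix b (leftmost_leaf T)"
    and k: "k = leftmost_leaf T ! length b" and next_child: "b @ [k + 1] \<in> T"
    and T': "T' = T - {b @ [k] @ \<tau> | \<tau>. True}"
  shows "comb h T'"
proof -
  define c where "c = leftmost_leaf T"
  have fin: "finite T" and tree: "rooted_tree T" and h: "height T \<le> h"
    and iv: "\<And>\<sigma>. \<sigma> \<in> T \<Longrightarrow> \<not> leaf T \<sigma> \<Longrightarrow> \<exists>i j. i \<le> j \<and> {k. \<sigma> @ [k] \<in> T} = {i..j}"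
    and par: "\<And>\<sigma> k. leaf T (\<sigma> @ [k]) \<Longrightarrow> strict_prefix \<sigma> c"
    using T by (auto simp: comb_def c_def)
  have c: "leaf T c" "\<And>\<tau>. leaf T \<tau> \<Longrightarrow> lexordp_eq c \<tau>"
    using leftmost_leaf[OF fin tree] by (auto simp: c_def)
  obtain \<sigma>0 where \<sigma>0: "c = b @ k # \<sigma>0"
    using b k by (auto simp: c_def[symmetric] elim!: strict_prefixE')
  have closed: "\<tau> \<in> T" if "\<sigma> \<in> T" "prefix \<tau> \<sigma>" for \<sigma> \<tau>
    using tree that by (auto simp: rooted_tree_def)
  have inT': "\<sigma> \<in> T' \<longleftrightarrow> \<sigma> \<in> T \<and> \<not> prefix (b @ [k]) \<sigma>" for \<sigma>
    by (auto simp: T' prefix_def)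
  have fin': "finite T'" using fin T' by simp
  have next': "b @ [k + 1] \<in> T'" using next_child by (auto simp: inT')
  have bT': "b \<in> T'" using closed[OF next_child, of b] by (auto simp: inT' prefix_def)
  have tree': "rooted_tree T'"
    unfolding rooted_tree_def
  proof (intro conjI ballI allI impI)
    show "T' \<noteq> {}" using bT' by blast
  next
    fix \<sigma> \<tau> assume st: "\<sigma> \<in> T'" "prefix \<tau> \<sigma>"
    then have "\<not> prefix (b @ [k]) \<tau>" using prefix_order.trans inT' by blast
    then show "\<tau> \<in> T'" using closed[of \<sigma> \<tau>] st inT' by blast
  qed
  have h': "height T' \<le> h"
  proof -
    have "\<forall>\<sigma>\<in>T. length \<sigma> \<le> h" using h height_le[OF fin, of h] bT' by (auto simp: inT')
    moreover have "T' \<noteq> {}" using bT' by blast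
    ultimately show ?thesis using height_le[OF fin', of h] by (simp add: inT')
  qed
  have child: "\<sigma> @ [j] \<in> T' \<longleftrightarrow> \<sigma> @ [j] \<in> T \<and> (\<sigma>, j) \<noteq> (b, k)" if "\<sigma> \<in> T'" for \<sigma> j
    using that by (auto simp: inT' prefix_snoc)
  have leaves: "leaf T' \<tau> \<longleftrightarrow> leaf T \<tau> \<and> \<not> prefix (b @ [k]) \<tau>" for \<tau>
  proof
    assume l: "leaf T' \<tau>"
    then have "\<tau> \<in> T'" "\<tau> \<noteq> b" using next' by (auto simp: leaf_def)
    then show "leaf T \<tau> \<and> \<not> prefix (b @ [k]) \<tau>"
      using l child[of \<tau>] inT'[of \<tau>] unfolding leaf_def by blast
  next
    assume "leaf T \<tau> \<and> \<not> prefix (b @ [k]) \<tau>"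
    then show "leaf T' \<tau>" by (auto simp: leaf_def inT')
  qed
  have "leaf T (b @ [k + 1])"
  proof -
    obtain \<tau> where \<tau>: "leaf T \<tau>" "prefix (b @ [k + 1]) \<tau>" using leaf_above[OF fin next_child] .
    show ?thesis
    proof (cases "\<tau> = b @ [k + 1]")
      case False
      then obtain \<rho> where "\<tau> = b @ [k + 1] @ \<rho>" "\<rho> \<noteq> []" using \<tau>(2) by (auto simp: prefix_def)
      then obtain \<upsilon> j where "\<tau> = b @ [k + 1] @ \<upsilon> @ [j]" by (cases \<rho> rule: rev_cases) auto
      then have "strict_prefix (b @ [k + 1] @ \<upsilon>) c" using par \<tau>(1) by auto
      then show ?thesis using \<sigma>0 by (auto simp: strict_prefix_def prefix_def)
    qed (use \<tau> in simp)
  qed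
  then have lf: "leaf T' (b @ [k + 1])" by (simp add: leaves)
  have c': "leftmost_leaf T' = b @ [k + 1]"
    using lf by (rule leftmost_leaf_eqI) (metis c(2) \<sigma>0 lexordp_eq_next leaves)
  have k_least: "\<not> i < k" if i: "b @ [i] \<in> T" for i
  proof
    assume "i < k"
    obtain \<tau> where \<tau>: "leaf T \<tau>" "prefix (b @ [i]) \<tau>" using leaf_above[OF fin i] .
    then obtain \<upsilon> where \<upsilon>: "\<tau> = b @ i # \<upsilon>" by (auto simp: prefix_def)
    have "\<not> lexordp_eq (b @ k # \<sigma>0) (b @ i # \<upsilon>)" using \<open>i < k\<close> by (induction b) auto
    then show False using c(2)[OF \<tau>(1)] \<sigma>0 \<upsilon> by simp
  qed
  have "\<exists>i j. i \<le> j \<and> {k. \<sigma> @ [k] \<in> T'} = {i..j}" if \<sigma>: "\<sigma> \<in> T'" "\<not> leaf T' \<sigma>" for \<sigma>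
  proof -
    have "\<sigma> \<in> T" "\<not> leaf T \<sigma>" using \<sigma> by (auto simp: inT' leaves)
    then obtain i j where ij: "i \<le> j" "{k. \<sigma> @ [k] \<in> T} = {i..j}" using iv by blast
    show ?thesis
    proof (cases "\<sigma> = b")
      case False
      then have "{k. \<sigma> @ [k] \<in> T'} = {k. \<sigma> @ [k] \<in> T}" using child[OF \<sigma>(1)] by auto
      then show ?thesis using ij by auto
    next
      case True
      have mem: "b @ [l] \<in> T \<longleftrightarrow> l \<in> {i..j}" for l using ij(2) True by blast
      have "b @ [k] \<in> T" using closed[of c "b @ [k]"] c(1) \<sigma>0 by (auto simp: leaf_def)
      then have "i = k" using mem k_least[of i] ij(1) by fastforce
      then have "b @ [l] \<in> T' \<longleftrightarrow> l \<in> {k + 1..j}" for l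
        using child[OF bT', of l] mem[of l] by auto
      then have "{k. \<sigma> @ [k] \<in> T'} = {k + 1..j}" using True by blast
      moreover have "k + 1 \<le> j" using mem next_child by auto
      ultimately show ?thesis by blast
    qed
  qed
  moreover have "strict_prefix \<sigma> (b @ [k + 1])" if l: "leaf T' (\<sigma> @ [j])" for \<sigma> j
  proof -
    have "strict_prefix \<sigma> (b @ k # \<sigma>0)" using l par \<sigma>0 leaves by auto
    moreover have "\<not> prefix (b @ [k]) \<sigma>" using l by (auto simp: leaves)
    ultimately show ?thesis
      by (auto simp: strict_prefix_def prefix_append prefix_Cons)
  qed
  ultimately show ?thesis using fin' tree' h' by (simp add: comb_def c')
qed

fun well_positioned :: "nat \<Rightarrow> state \<Rightarrow> bool" where
  "well_positioned h (At T \<rho>) = possible_position h T \<rho>"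
| "well_positioned h (Queried T \<rho> Q) = possible_position h T \<rho>"
| "well_positioned h (Replied T \<rho>) = possible_position h T \<rho>"
| "well_positioned h _ = True"

lemma well_positioned_next:
  "well_positioned h s \<Longrightarrow> legal prec s m \<Longrightarrow> well_positioned h (next_state h s m)"
proof (induction prec s m rule: legal.induct)
  case (4 prec T \<rho> b)
  let ?T' = "T \<union> {leftmost_leaf T @ [i] | i. i \<le> b}"
  have "comb h ?T'" if "height ?T' \<le> h"
    using 4 comb_extend[OF _ refl that] by (simp add: possible_position_def)
  then show ?case using 4 by (simp add: possible_position_def Let_def)
next
  case (5 prec T \<rho> b)
  let ?k = "leftmost_leaf T ! length b"
  have "comb h (T - {b @ [?k] @ \<tau> | \<tau>. True})" if "b @ [?k + 1] \<in> T"
    using 5 comb_backtrack[OF _ _ refl that refl] by (simp add: possible_position_def)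
  then show ?case using 5 by (simp add: possible_position_def Let_def)
qed (simp_all add: possible_position_def comb_root)

lemma well_positioned_state_after:
  "legal_history prec h ms \<Longrightarrow> well_positioned h (state_after h ms)"
proof (induction ms rule: rev_induct)
  case Nil
  then show ?case by (simp add: state_after_def)
next
  case (snoc m ms)
  have "legal_history prec h ms"
    unfolding legal_history_def
  proof (intro allI impI)
    fix i assume "i < length ms"
    then show "legal prec (state_after h (take i ms)) (ms ! i)"
      using snoc.prems[unfolded legal_history_def, rule_format, of i] by (simp add: nth_append)
  qed
  moreover have "legal prec (state_after h ms) m"
    using snoc.prems[unfolded legal_history_def, rule_format, of "length ms"] by simp
  ultimately show ?case using snoc.IH well_positioned_next by (simp add: state_after_def)
qed

end

theory Submission
  imports Defs
begin

text \<open>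
  If the order type of \<open>\<prec>\<close> is at most \<open>\<omega>\<^sup>h\<close>, elements have strictly monotone lexicographic codes of
  length \<open>h\<close>. Prover always queries the least number answered 1, which forces a descent, and keeps
  the numbers of siblings to the right of the leftmost branch at least as large as the code of
  that number: if the code has dropped below these numbers, Prover backtracks where it first
  differs, otherwise extends the branch by the next entry of the code.

  If the order type exceeds every \<open>\<omega>\<^sup>h\<close>, we refute provability by forcing a generic \<open>X\<close> without least
  element over a nonstandard model. A condition is a finite part of \<open>X\<close> together with an interval of
  length \<open>\<omega>\<^sup>k\<close>, with \<open>k\<close> nonstandard, below its ones. Everything bounded is decided for free by
  answering 0; a new smaller element costs one unit of \<open>k\<close>; and an instance of \<open>\<Sigma>\<^sub>1\<close>-induction up to
  \<open>b\<close> costs one unit as well, because \<open>\<omega>\<^sup>k\<close> consists of more than \<open>b\<close> intervals of length \<open>\<omega>\<^sup>k\<^sup>-\<^sup>1\<close>.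
\<close>

section \<open>Distances in a well-order\<close>

locale nat_wellorder =
  fixes prec :: "nat \<Rightarrow> nat \<Rightarrow> bool" (infix "\<prec>" 50)
  assumes wf: "wfp (\<prec>)" and trans: "transp (\<prec>)" and total: "totalp (\<prec>)"
begin

definition preceq :: "nat \<Rightarrow> nat \<Rightarrow> bool" (infix "\<preceq>" 50) where
  "x \<preceq> y \<longleftrightarrow> \<not> y \<prec> x"

sublocale wo: wellorder "(\<preceq>)" "(\<prec>)"
proof
  have irr: "\<not> x \<prec> x" for x
    using wf by (induction x rule: wfp_induct_rule) blast
  have tr: "x \<prec> y \<Longrightarrow> y \<prec> z \<Longrightarrow> x \<prec> z" for x y z
    using trans by (blast dest: transpD)
  have tot: "x \<noteq> y \<Longrightarrow> x \<prec> y \<or> y \<prec> x" for x y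
    using total by (blast dest: totalpD)
  fix x y z :: nat
  show "x \<prec> y \<longleftrightarrow> x \<preceq> y \<and> \<not> y \<preceq> x" using irr tr by (auto simp: preceq_def)
  show "x \<preceq> x" using irr by (simp add: preceq_def)
  show "x \<preceq> y \<Longrightarrow> y \<preceq> z \<Longrightarrow> x \<preceq> z" using tr tot by (metis preceq_def)
  show "x \<preceq> y \<Longrightarrow> y \<preceq> x \<Longrightarrow> x = y" using tot by (auto simp: preceq_def)
  show "x \<preceq> y \<or> y \<preceq> x" using irr tr by (auto simp: preceq_def)
  fix P a assume "\<And>x. (\<And>y. y \<prec> x \<Longrightarrow> P y) \<Longrightarrow> P x"
  then show "P a" using wf by (metis wfp_induct_rule)
qed

text \<open>\<open>far a x y\<close> says that \<open>y\<close> has rank at least the rank of \<open>x\<close> plus \<open>\<omega>\<^sup>a\<close>.\<close>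

primrec far :: "nat \<Rightarrow> nat \<Rightarrow> nat \<Rightarrow> bool" where
  "far 0 = (\<prec>)"
| "far (Suc a) = (\<lambda>x y. \<forall>j. (far a ^^ Suc j) x y)"

declare far.simps(2) [simp del]

lemma far_SucD: "far (Suc a) x y \<Longrightarrow> (far a ^^ Suc j) x y"
  by (simp add: far.simps(2) del: relpowp.simps)

lemma far_pred: "far (Suc a) x y \<Longrightarrow> far a x y"
  using far_SucD[of a x y 0] by (simp add: eq_OO)

lemma far_antimono: "far a x y \<Longrightarrow> b \<le> a \<Longrightarrow> far b x y"
  by (induction a) (auto simp: le_Suc_eq dest: far_pred)

lemma far_less: "far a x y \<Longrightarrow> x \<prec> y"
  using far_antimono[of a x y 0] by simp

lemma far_less_trans: "far a x y \<Longrightarrow> y \<prec> z \<Longrightarrow> far a x z"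
proof (induction a arbitrary: x y z)
  case 0
  then show ?case by (auto intro: wo.less_trans)
next
  case (Suc a)
  have "(far a ^^ Suc j) x z" for j
    using far_SucD[OF Suc.prems(1), of j] Suc.IH Suc.prems(2) by auto
  then show ?case by (simp add: far.simps(2) del: relpowp.simps)
qed

lemma far_le_trans: "far a x y \<Longrightarrow> y \<preceq> z \<Longrightarrow> far a x z"
  using far_less_trans by (auto simp: wo.le_less)

text \<open>The first step already covers the distance, and \<open>far_less_trans\<close> absorbs
  the later ones.\<close>

lemma chain_far: "(far a ^^ Suc j) x y \<Longrightarrow> far a x y"
proof (induction j arbitrary: y)
  case 0
  then show ?case by (simp add: eq_OO)
next
  case (Suc j)
  obtain z where "(far a ^^ Suc j) x z" "far a z y" using relpowp_Suc_E[OF Suc.prems] .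
  then show ?case using Suc.IH far_less_trans far_less by blast
qed

lemma chain_le_trans:
  assumes "(far a ^^ Suc j) x y" "y \<preceq> z"
  shows "(far a ^^ Suc j) x z"
proof -
  obtain w where "(far a ^^ j) x w" "far a w y" using relpowp_Suc_E[OF assms(1)] .
  then show ?thesis using far_le_trans[OF _ assms(2)] by (metis relpowp_Suc_I)
qed

text \<open>A chain of \<open>j + 1\<close> steps has \<open>j\<close> distinct interior points,
  each far from \<open>x\<close> by \<open>chain_far\<close>. This is how a finite condition always
  finds an undecided point in its interval.\<close>

lemma infinite_far_below:
  assumes "far (Suc a) x y"
  shows "infinite {z. far a x z \<and> z \<prec> y}"
proof
  assume fin: "finite {z. far a x z \<and> z \<prec> y}"
  have "\<exists>W \<subseteq> {z. far a x z \<and> z \<prec> y}. finite W \<and> card W = j" if "(far a ^^ Suc j) x y" for j y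
    using that
  proof (induction j arbitrary: y)
    case 0
    show ?case by (rule exI[of _ "{}"]) simp
  next
    case (Suc j)
    obtain z where z: "(far a ^^ Suc j) x z" "far a z y"
      using relpowp_Suc_E[OF Suc.prems] .
    obtain W where W: "W \<subseteq> {w. far a x w \<and> w \<prec> z}" "finite W" "card W = j"
      using Suc.IH[OF z(1)] by blast
    have "z \<notin> W" using W(1) by auto
    moreover have "z \<prec> y" "far a x z" using z far_less chain_far by blast+
    ultimately show ?case
      using W by (intro exI[of _ "insert z W"]) (auto intro: wo.less_trans)
  qed
  from this[OF far_SucD[OF assms]] obtain W
    where W: "W \<subseteq> {z. far a x z \<and> z \<prec> y}" "card W = Suc (card {z. far a x z \<and> z \<prec> y})"
    by blast
  show False using card_mono[OF fin W(1)] W(2) by simp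
qed

section \<open>Ranks below a power of omega\<close>

text \<open>The code of \<open>w\<close> over the base \<open>x\<close> lists the coefficients in
  the Cantor normal form of the distance, from exponent \<open>a - 1\<close> down. Not being far is
  assumed of the larger point only, since it passes to smaller ones.\<close>

lemma ex_code:
  "\<exists>f. (\<forall>x w. length (f x w) = a) \<and>
     (\<forall>x w w'. x \<preceq> w \<longrightarrow> w \<prec> w' \<longrightarrow> \<not> far a x w' \<longrightarrow> ord_class.lexordp (f x w :: nat list) (f x w'))"
proof (induction a)
  case 0
  show ?case by (rule exI[of _ "\<lambda>_ _. []"]) (auto dest: wo.le_less_trans)
next
  case (Suc a)
  then obtain f :: "nat \<Rightarrow> nat \<Rightarrow> nat list" where f: "\<And>x w. length (f x w) = a"
    "\<And>x w w'. x \<preceq> w \<Longrightarrow> w \<prec> w' \<Longrightarrow> \<not> far a x w' \<Longrightarrow> ord_class.lexordp (f x w) (f x w')"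
    by blast
  \<comment> \<open>As the least \<open>j\<close> for which \<open>j + 1\<close> steps fail, this is
    the leading coefficient.\<close>
  define K where "K x w = (LEAST j. \<not> (far a ^^ Suc j) x w)" for x w
  \<comment> \<open>The remainder is coded over this end point of \<open>k\<close> steps. It depends
    on \<open>x\<close> and the coefficient alone, so codes with equal leading entries are compared
    over a common base.\<close>
  define Z where "Z x k = wo.Least (\<lambda>z. (far a ^^ k) x z)" for x k
  have K: "\<not> (far a ^^ Suc (K x w)) x w" if "\<not> far (Suc a) x w" for x w
    unfolding K_def by (rule LeastI_ex) (use that in \<open>auto simp: far.simps(2) simp del: relpowp.simps\<close>)
  have below_K: "(far a ^^ Suc j) x w" if "j < K x w" for j x w
    using not_less_Least[OF that[unfolded K_def]] by blast
  have Z: "Z x (K x w) \<preceq> w \<and> \<not> far a (Z x (K x w)) w" if xw: "x \<preceq> w" and nf: "\<not> far (Suc a) x w" for x w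
  proof (cases "K x w")
    case 0
    have "Z x 0 = x" unfolding Z_def by (simp add: wo.Least_equality)
    then show ?thesis using 0 K[OF nf] xw by (simp add: eq_OO)
  next
    case (Suc j)
    have ch: "(far a ^^ K x w) x w" using below_K[of j x w] Suc by simp
    have "(far a ^^ K x w) x (Z x (K x w))" unfolding Z_def using ch by (rule wo.LeastI)
    then have "\<not> far a (Z x (K x w)) w" using K[OF nf] relpowp_Suc_I by metis
    moreover have "Z x (K x w) \<preceq> w" unfolding Z_def using ch by (rule wo.Least_le)
    ultimately show ?thesis by blast
  qed
  define g where "g x w = K x w # f (Z x (K x w)) w" for x w
  have "ord_class.lexordp (g x w) (g x w')" if xw: "x \<preceq> w" "w \<prec> w'" and nf: "\<not> far (Suc a) x w'" for x w w'
  proof -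
    have nf': "\<not> far (Suc a) x w" using nf far_less_trans xw(2) by blast
    have "\<not> K x w' < K x w"
    proof
      assume "K x w' < K x w"
      then have "(far a ^^ Suc (K x w')) x w'"
        using below_K chain_le_trans xw(2) wo.less_imp_le by blast
      then show False using K[OF nf] by blast
    qed
    moreover have "ord_class.lexordp (f (Z x (K x w)) w) (f (Z x (K x w)) w')" if "K x w = K x w'"
    proof (rule f(2))
      show "Z x (K x w) \<preceq> w" using Z[OF xw(1) nf'] by blast
      have "x \<preceq> w'" using xw wo.less_imp_le wo.order_trans by blast
      then show "\<not> far a (Z x (K x w)) w'" using Z nf that by metis
    qed (rule xw(2))
    ultimately show ?thesis
      using linorder_less_linear[of "K x w" "K x w'"] by (auto simp: g_def)
  qed
  then show ?case using f(1) by (intro exI[of _ g]) (auto simp: g_def)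
qed

lemma ex_lex_embedding:
  assumes "\<And>x y. \<not> far h x y"
  obtains f :: "nat \<Rightarrow> nat list" where
    "\<And>x. length (f x) = h" "\<And>x y. x \<prec> y \<Longrightarrow> ord_class.lexordp (f x) (f y)"
proof -
  obtain f :: "nat \<Rightarrow> nat \<Rightarrow> nat list" where f: "\<And>x w. length (f x w) = h"
    "\<And>x w w'. x \<preceq> w \<Longrightarrow> w \<prec> w' \<Longrightarrow> \<not> far h x w' \<Longrightarrow> ord_class.lexordp (f x w) (f x w')"
    using ex_code[of h] by blast
  define o0 where "o0 = wo.Least (\<lambda>_. True)"
  have "o0 \<preceq> w" for w unfolding o0_def by (rule wo.Least_le) simp
  then show ?thesis using that[of "f o0"] f assms by blast
qed

end

section \<open>Terms and formulas\<close>

lemma neg_neg [simp]: "neg (neg A) = A"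
  by (induction A) auto

lemma holds_neg [simp]: "holds X e (neg A) \<longleftrightarrow> \<not> holds X e A"
  by (induction A arbitrary: e) auto

lemma literal_neg [simp]: "literal (neg A) = literal A"
  by (cases A) auto

lemma wf_neg [simp]: "wf_fm (neg A) = wf_fm A"
  by (induction A) auto

lemma neg_subst: "neg (subst s A) = subst s (neg A)"
  by (induction A arbitrary: s) auto

lemma Delta0_X_neg: "Delta0_X A \<Longrightarrow> Delta0_X (neg A)"
  by (induction rule: Delta0_X.induct) (auto intro: Delta0_X.intros)

lemma eval_subst_tm: "eval_tm e (subst_tm s t) = eval_tm (\<lambda>i. eval_tm e (s i)) t"
  by (induction t) (auto simp: comp_def cong: map_cong)

lemma eval_lift_tm [simp]: "eval_tm (case_nat x e) (lift_tm t) = eval_tm e t"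
  by (simp add: lift_tm_def eval_subst_tm)

lemma eval_succ_tm [simp]: "eval_tm e (succ_tm t) = Suc (eval_tm e t)"
  by (simp add: succ_tm_def binary_fsym_def const_sym_def)

lemma eval_zero_tm [simp]: "eval_tm e zero_tm = 0"
  by (simp add: zero_tm_def const_sym_def)

text \<open>The finite set may depend on \<open>e\<close>, through the values of quantifier bounds.
  In a fixed environment, a finite part of \<open>X\<close> then decides a bounded formula.\<close>

definition finitely_determined :: "fm \<Rightarrow> bool" where
  "finitely_determined A \<longleftrightarrow>
     (\<forall>e. \<exists>F. finite F \<and> (\<forall>X Y. X \<inter> F = Y \<inter> F \<longrightarrow> holds X e A = holds Y e A))"

lemma finitely_determined_literal: "literal A \<Longrightarrow> finitely_determined A"
  unfolding finitely_determined_def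
proof
  fix e assume "literal A"
  then consider p ts where "A = Atom p ts \<or> A = NAtom p ts" | t where "A = InX t \<or> A = NotInX t"
    by (cases A) auto
  then show "\<exists>F. finite F \<and> (\<forall>X Y. X \<inter> F = Y \<inter> F \<longrightarrow> holds X e A = holds Y e A)"
  proof cases
    case 1
    then show ?thesis by (intro exI[of _ "{}"]) auto
  next
    case (2 t)
    then show ?thesis by (intro exI[of _ "{eval_tm e t}"]) auto
  qed
qed

lemma finitely_determined_And:
  assumes "finitely_determined A" "finitely_determined B"
  shows "finitely_determined (And A B)"
  unfolding finitely_determined_def
proof
  fix e
  obtain F where F: "finite F" "\<And>X Y. X \<inter> F = Y \<inter> F \<Longrightarrow> holds X e A = holds Y e A"
    using assms(1) unfolding finitely_determined_def by meson
  obtain G where G: "finite G" "\<And>X Y. X \<inter> G = Y \<inter> G \<Longrightarrow> holds X e B = holds Y e B"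
    using assms(2) unfolding finitely_determined_def by meson
  have "holds X e (And A B) = holds Y e (And A B)" if "X \<inter> (F \<union> G) = Y \<inter> (F \<union> G)" for X Y
  proof -
    have "X \<inter> F = Y \<inter> F" "X \<inter> G = Y \<inter> G" using that by blast+
    then show ?thesis using F(2)[of X Y] G(2)[of X Y] by simp
  qed
  then show "\<exists>F. finite F \<and> (\<forall>X Y. X \<inter> F = Y \<inter> F \<longrightarrow> holds X e (And A B) = holds Y e (And A B))"
    using F(1) G(1) by (intro exI[of _ "F \<union> G"]) blast
qed

lemma finitely_determined_neg [simp]: "finitely_determined (neg A) = finitely_determined A"
  by (simp add: finitely_determined_def)

lemma finitely_determined_bounded:
  assumes "finitely_determined A"
  obtains F where "finite F"
    "\<And>X Y x. X \<inter> F = Y \<inter> F \<Longrightarrow> x \<le> b \<Longrightarrow> holds X (case_nat x e) A = holds Y (case_nat x e) A"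
proof -
  have "\<forall>x. \<exists>F. finite F \<and>
      (\<forall>X Y. X \<inter> F = Y \<inter> F \<longrightarrow> holds X (case_nat x e) A = holds Y (case_nat x e) A)"
    using assms unfolding finitely_determined_def by blast
  then obtain F where F: "\<And>x. finite (F x)"
    "\<And>X Y x. X \<inter> F x = Y \<inter> F x \<Longrightarrow> holds X (case_nat x e) A = holds Y (case_nat x e) A"
    by metis
  show ?thesis
  proof (rule that[of "\<Union>x\<le>b. F x"])
    show "finite (\<Union>x\<le>b. F x)" using F(1) by blast
    fix X Y x assume "X \<inter> (\<Union>x\<le>b. F x) = Y \<inter> (\<Union>x\<le>b. F x)" "x \<le> b"
    then have "X \<inter> F x = Y \<inter> F x" by blast
    then show "holds X (case_nat x e) A = holds Y (case_nat x e) A" by (rule F(2))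
  qed
qed

lemma holds_bounded_Exists:
  "holds X e (Exists (And (Atom le_sym [Var 0, lift_tm t]) A)) \<longleftrightarrow>
     (\<exists>x\<le>eval_tm e t. holds X (case_nat x e) A)"
  by (auto simp: binary_psym_def)

lemma finitely_determined_bounded_Exists:
  assumes "finitely_determined A"
  shows "finitely_determined (Exists (And (Atom le_sym [Var 0, lift_tm t]) A))"
  unfolding finitely_determined_def
proof
  fix e
  obtain F where F: "finite F" "\<And>X Y x. X \<inter> F = Y \<inter> F \<Longrightarrow> x \<le> eval_tm e t \<Longrightarrow>
      holds X (case_nat x e) A = holds Y (case_nat x e) A"
    using finitely_determined_bounded[OF assms] by metis
  show "\<exists>F. finite F \<and> (\<forall>X Y. X \<inter> F = Y \<inter> F \<longrightarrow>
      holds X e (Exists (And (Atom le_sym [Var 0, lift_tm t]) A)) =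
      holds Y e (Exists (And (Atom le_sym [Var 0, lift_tm t]) A)))"
    unfolding holds_bounded_Exists
  proof (intro exI[of _ F] conjI allI impI)
    fix X Y assume "X \<inter> F = Y \<inter> F"
    then show "(\<exists>x\<le>eval_tm e t. holds X (case_nat x e) A) = (\<exists>x\<le>eval_tm e t. holds Y (case_nat x e) A)"
      using F(2) by metis
  qed (rule F(1))
qed

lemma finitely_determined_Delta0: "Delta0_X A \<Longrightarrow> finitely_determined A"
proof (induction rule: Delta0_X.induct)
  case (1 A)
  then show ?case by (simp add: finitely_determined_literal)
next
  case (2 A B)
  then show ?case by (simp add: finitely_determined_And)
next
  case (3 A B)
  then have "finitely_determined (neg (And (neg A) (neg B)))"
    by (simp only: finitely_determined_neg finitely_determined_And)
  then show ?case by simp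
next
  case (4 A t)
  then have "finitely_determined (neg (Exists (And (Atom le_sym [Var 0, lift_tm t]) (neg A))))"
    by (simp only: finitely_determined_neg finitely_determined_bounded_Exists)
  then show ?case by simp
next
  case (5 A t)
  then show ?case by (simp only: finitely_determined_bounded_Exists)
qed

section \<open>Conditions\<close>

definition agrees :: "nat set \<Rightarrow> partial_predicate \<Rightarrow> bool" where
  "agrees X \<rho> \<longleftrightarrow> (\<forall>x b. \<rho> x = Some b \<longrightarrow> (x \<in> X \<longleftrightarrow> b))"

definition settles :: "partial_predicate \<Rightarrow> (nat \<Rightarrow> nat) \<Rightarrow> fm \<Rightarrow> bool" where
  "settles \<rho> e A \<longleftrightarrow> (\<forall>X. agrees X \<rho> \<longrightarrow> holds X e A)"

text \<open>Reading undecided points as 0 gives one concrete completion in which settled formulas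
  can be evaluated.\<close>

lemma agrees_ones: "agrees {x. \<rho> x = Some True} \<rho>"
  by (auto simp: agrees_def)

lemma agrees_antimono: "\<rho> \<subseteq>\<^sub>m \<rho>' \<Longrightarrow> agrees X \<rho>' \<Longrightarrow> agrees X \<rho>"
  unfolding agrees_def map_le_def by (metis domI)

lemma settles_mono: "settles \<rho> e A \<Longrightarrow> \<rho> \<subseteq>\<^sub>m \<rho>' \<Longrightarrow> settles \<rho>' e A"
  unfolding settles_def using agrees_antimono by blast

lemma agrees_Int: "agrees X \<rho> \<Longrightarrow> agrees Y \<rho> \<Longrightarrow> F \<subseteq> dom \<rho> \<Longrightarrow> X \<inter> F = Y \<inter> F"
  by (fastforce simp: agrees_def)

lemma settles_consistent: "settles \<rho> e A \<Longrightarrow> settles \<rho> e (neg A) \<Longrightarrow> False"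
  using agrees_ones unfolding settles_def holds_neg by blast

lemma settles_InX: "settles \<rho> e (InX t) \<Longrightarrow> \<rho> (eval_tm e t) = Some True"
  using agrees_ones[of \<rho>] unfolding settles_def by fastforce

lemma settles_NotInX: "settles \<rho> e (NotInX t) \<Longrightarrow> \<rho> (eval_tm e t) \<noteq> Some True"
  using agrees_ones[of \<rho>] unfolding settles_def by fastforce

text \<open>
  Conditions force over a reduced power of the standard model: its elements are functions of an
  index, and the infinite sets of indices approximate a generic ultrafilter. In a cell, \<open>val\<close>
  is the part of \<open>X\<close> decided so far at that index, and the interval between \<open>lo\<close> and \<open>hi\<close> is
  the room left for further, smaller elements of \<open>X\<close>.
\<close>

datatype cell = Cell (val: partial_predicate) (lo: nat) (hi: nat)

datatype condition = Cond (inds: "nat set") (cells: "nat \<Rightarrow> cell")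

text \<open>Environments take the index of the reduced power first and the variable second. An
  element of the power is a function of the index, and pushing it makes it variable 0.\<close>

definition push :: "(nat \<Rightarrow> nat) \<Rightarrow> (nat \<Rightarrow> nat \<Rightarrow> nat) \<Rightarrow> nat \<Rightarrow> nat \<Rightarrow> nat" where
  "push f e = (\<lambda>n. case_nat (f n) (e n))"

lemma push_apply [simp]: "push f e n = case_nat (f n) (e n)"
  by (simp add: push_def)

context nat_wellorder
begin

text \<open>With all ones at or above \<open>hi\<close>, an undecided point of the interval below
  \<open>hi\<close> can become a one smaller than all others.\<close>

definition cell_ok :: "cell \<Rightarrow> bool" where
  "cell_ok c \<longleftrightarrow> finite (dom (val c)) \<and> lo c \<prec> hi c \<and> (\<forall>x. val c x = Some True \<longrightarrow> hi c \<preceq> x)"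

definition refines :: "cell \<Rightarrow> cell \<Rightarrow> bool" where
  "refines d c \<longleftrightarrow> val c \<subseteq>\<^sub>m val d \<and> lo c \<preceq> lo d \<and> hi d \<preceq> hi c"

text \<open>By the last clause every standard exponent is available at all but finitely many
  indices, so in the reduced power the exponent is nonstandard.\<close>

definition is_cond :: "condition \<Rightarrow> bool" where
  "is_cond p \<longleftrightarrow> infinite (inds p) \<and> (\<forall>n\<in>inds p. cell_ok (cells p n)) \<and>
     (\<forall>k. finite {n \<in> inds p. \<not> far k (lo (cells p n)) (hi (cells p n))})"

definition extends :: "condition \<Rightarrow> condition \<Rightarrow> bool" (infix "\<sqsubseteq>" 50) where
  "q \<sqsubseteq> p \<longleftrightarrow> is_cond q \<and> inds q \<subseteq> inds p \<and> (\<forall>n\<in>inds q. refines (cells q n) (cells p n))"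

lemma refines_refl: "refines c c"
  by (simp add: refines_def)

lemma refines_trans: "refines c d \<Longrightarrow> refines d d' \<Longrightarrow> refines c d'"
  unfolding refines_def using map_le_trans wo.order_trans by blast

lemma extends_refl: "is_cond p \<Longrightarrow> p \<sqsubseteq> p"
  by (simp add: extends_def refines_refl)

lemma extends_trans: "r \<sqsubseteq> q \<Longrightarrow> q \<sqsubseteq> p \<Longrightarrow> r \<sqsubseteq> p"
  unfolding extends_def using refines_trans by blast

lemma extends_is_cond: "q \<sqsubseteq> p \<Longrightarrow> is_cond q"
  by (simp add: extends_def)

lemma extends_inds: "q \<sqsubseteq> p \<Longrightarrow> n \<in> inds q \<Longrightarrow> n \<in> inds p"
  by (auto simp: extends_def)

lemma extends_settles:
  assumes "q \<sqsubseteq> p" "n \<in> inds q" "settles (val (cells p n)) e A"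
  shows "settles (val (cells q n)) e A"
  using assms settles_mono unfolding extends_def refines_def by blast

lemma extends_nonempty: "q \<sqsubseteq> p \<Longrightarrow> \<exists>n. n \<in> inds q \<and> n \<in> inds p"
  by (auto simp: extends_def is_cond_def dest!: infinite_imp_nonempty)

section \<open>Thinning and refining conditions\<close>

lemma restrict_cond:
  assumes "is_cond p" "infinite S" "S \<subseteq> inds p"
  shows "Cond S (cells p) \<sqsubseteq> p"
proof -
  have "finite {n \<in> S. \<not> far k (lo (cells p n)) (hi (cells p n))}" for k
    using assms by (auto simp: is_cond_def elim!: rev_finite_subset)
  then show ?thesis using assms by (auto simp: extends_def is_cond_def refines_refl)
qed

text \<open>One of two sets covering an infinite set is infinite. This turns an alternative that
  holds index by index into a uniform one, at no cost to the cells.\<close>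

lemma split_cond:
  assumes p: "is_cond p" and PQ: "\<And>n. n \<in> inds p \<Longrightarrow> P n \<or> Q n"
  obtains q where "q \<sqsubseteq> p" "cells q = cells p" "(\<forall>n\<in>inds q. P n) \<or> (\<forall>n\<in>inds q. Q n)"
proof -
  have "inds p = {n \<in> inds p. P n} \<union> {n \<in> inds p. Q n}" using PQ by blast
  then have "infinite {n \<in> inds p. P n} \<or> infinite {n \<in> inds p. Q n}"
    using p unfolding is_cond_def by (metis finite_Un)
  then show ?thesis
  proof
    assume "infinite {n \<in> inds p. P n}"
    then show ?thesis using that[OF restrict_cond[OF p]] by auto
  next
    assume "infinite {n \<in> inds p. Q n}"
    then show ?thesis using that[OF restrict_cond[OF p]] by auto
  qed
qed

text \<open>The exponents available in the cells of a condition tend to infinity, so one may be spent.\<close>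

lemma refine_cond:
  assumes p: "is_cond p"
    and R: "\<And>n k. n \<in> inds p \<Longrightarrow> far (Suc k) (lo (cells p n)) (hi (cells p n)) \<Longrightarrow>
      \<exists>d. cell_ok d \<and> refines d (cells p n) \<and> far k (lo d) (hi d) \<and> R n d"
  obtains q where "q \<sqsubseteq> p" "\<And>n. n \<in> inds q \<Longrightarrow> R n (cells q n)"
proof -
  let ?far = "\<lambda>k n. far k (lo (cells p n)) (hi (cells p n))"
  \<comment> \<open>Here exponent 0 is left after the payment; only finitely many indices are
    lost.\<close>
  define S where "S = {n \<in> inds p. ?far 1 n}"
  have "inds p = S \<union> {n \<in> inds p. \<not> ?far 1 n}" by (auto simp: S_def)
  moreover have "finite {n \<in> inds p. \<not> ?far 1 n}" using p by (simp only: is_cond_def)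
  ultimately have S: "infinite S" using p unfolding is_cond_def by (metis finite_Un)
  have "\<exists>d. cell_ok d \<and> refines d (cells p n) \<and> R n d \<and>
      (\<forall>k\<le>n. ?far (Suc k) n \<longrightarrow> far k (lo d) (hi d))" if n: "n \<in> S" for n
  proof -
    \<comment> \<open>A single interval may admit every exponent, so the maximum is taken up to
      \<open>n\<close>; this cap still tends to infinity with the index.\<close>
    define K where "K = Max {k. k \<le> n \<and> ?far (Suc k) n}"
    have fin: "finite {k. k \<le> n \<and> ?far (Suc k) n}" by simp
    have "0 \<in> {k. k \<le> n \<and> ?far (Suc k) n}" using n by (simp add: S_def)
    then have "K \<in> {k. k \<le> n \<and> ?far (Suc k) n}" unfolding K_def using Max_in[OF fin] by blast
    then obtain d where d: "cell_ok d" "refines d (cells p n)" "far K (lo d) (hi d)" "R n d"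
      using R[of n K] n by (auto simp: S_def)
    have "far k (lo d) (hi d)" if "k \<le> n" "?far (Suc k) n" for k
      using that far_antimono[OF d(3)] Max_ge[OF fin] by (simp add: K_def)
    then show ?thesis using d by blast
  qed
  then obtain D where D: "\<And>n. n \<in> S \<Longrightarrow> cell_ok (D n) \<and> refines (D n) (cells p n) \<and> R n (D n) \<and>
      (\<forall>k\<le>n. ?far (Suc k) n \<longrightarrow> far k (lo (D n)) (hi (D n)))"
    by metis
  have "finite {n \<in> S. \<not> far k (lo (D n)) (hi (D n))}" for k
  proof (rule finite_subset)
    \<comment> \<open>The indices below \<open>k\<close> are added because of the cap at
      \<open>n\<close>.\<close>
    show "{n \<in> S. \<not> far k (lo (D n)) (hi (D n))} \<subseteq> {n \<in> inds p. \<not> ?far (Suc k) n} \<union> {..<k}"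
      using D by (force simp: S_def not_less)
    show "finite ({n \<in> inds p. \<not> ?far (Suc k) n} \<union> {..<k})"
      using p unfolding is_cond_def by blast
  qed
  then have "is_cond (Cond S D)" using S D by (simp add: is_cond_def)
  then have "Cond S D \<sqsubseteq> p" using D by (auto simp: extends_def S_def)
  then show ?thesis using that[of "Cond S D"] D by simp
qed

text \<open>New values are all 0, which leaves the ones and hence the interval intact;
  \<open>far_pred\<close> merely drops the exponent that \<open>refine_cond\<close> takes.\<close>

lemma decide_points:
  assumes p: "is_cond p" and F: "\<And>n. finite (F n)"
  obtains q where "q \<sqsubseteq> p" "\<And>n. n \<in> inds q \<Longrightarrow> F n \<subseteq> dom (val (cells q n))"
proof (rule refine_cond[OF p, of "\<lambda>n d. F n \<subseteq> dom (val d)"])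
  fix n k assume n: "n \<in> inds p" and far: "far (Suc k) (lo (cells p n)) (hi (cells p n))"
  let ?c = "cells p n"
  let ?v = "\<lambda>x. if x \<in> F n \<and> val ?c x = None then Some False else val ?c x"
  have c: "cell_ok ?c" using p n by (simp add: is_cond_def)
  have "dom ?v = dom (val ?c) \<union> F n" by (auto simp: dom_def)
  then have "cell_ok (Cell ?v (lo ?c) (hi ?c))" "F n \<subseteq> dom ?v"
    using c F[of n] by (auto simp: cell_ok_def split: if_splits)
  moreover have "refines (Cell ?v (lo ?c) (hi ?c)) ?c" by (auto simp: refines_def map_le_def)
  ultimately show "\<exists>d. cell_ok d \<and> refines d ?c \<and> far k (lo d) (hi d) \<and> F n \<subseteq> dom (val d)"
    using far_pred[OF far] by (intro exI[of _ "Cell ?v (lo ?c) (hi ?c)"]) auto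
qed (use that in blast)

text \<open>Deciding a determining finite set at each index suffices. The verdict may vary with the
  index until \<open>split_cond\<close> makes it uniform.\<close>

lemma decide_formula:
  assumes p: "is_cond p" and A: "finitely_determined A"
  obtains q where "q \<sqsubseteq> p"
    "\<And>n. n \<in> inds q \<Longrightarrow> settles (val (cells q n)) (e n) A \<or> settles (val (cells q n)) (e n) (neg A)"
proof -
  define F where "F n = (SOME F. finite F \<and>
    (\<forall>X Y. X \<inter> F = Y \<inter> F \<longrightarrow> holds X (e n) A = holds Y (e n) A))" for n
  have F: "finite (F n) \<and> (\<forall>X Y. X \<inter> F n = Y \<inter> F n \<longrightarrow> holds X (e n) A = holds Y (e n) A)" for n
    unfolding F_def by (rule someI_ex) (use A in \<open>simp add: finitely_determined_def\<close>)
  obtain q where q: "q \<sqsubseteq> p" "\<And>n. n \<in> inds q \<Longrightarrow> F n \<subseteq> dom (val (cells q n))"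
    using decide_points[where F = F, OF p] F by blast
  have "settles (val (cells q n)) (e n) A \<or> settles (val (cells q n)) (e n) (neg A)"
    if n: "n \<in> inds q" for n
    using F[of n] agrees_Int[OF _ _ q(2)[OF n]] unfolding settles_def holds_neg by meson
  then show ?thesis using that q(1) by blast
qed

text \<open>By \<open>infinite_far_below\<close> some point of the interval, still at distance
  \<open>k\<close> above \<open>lo\<close>, is undecided. It becomes a one and the new
  \<open>hi\<close>, so the price is one exponent.\<close>

lemma add_one:
  assumes p: "is_cond p"
  obtains q where "q \<sqsubseteq> p"
    "\<And>n. n \<in> inds q \<Longrightarrow> val (cells q n) (hi (cells q n)) = Some True \<and> hi (cells q n) \<prec> hi (cells p n)"
proof (rule refine_cond[OF p, of "\<lambda>n d. val d (hi d) = Some True \<and> hi d \<prec> hi (cells p n)"])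
  fix n k assume n: "n \<in> inds p" and far: "far (Suc k) (lo (cells p n)) (hi (cells p n))"
  let ?c = "cells p n"
  have c: "cell_ok ?c" using p n by (simp add: is_cond_def)
  then have "\<not> {z. far k (lo ?c) z \<and> z \<prec> hi ?c} \<subseteq> dom (val ?c)"
    using infinite_far_below[OF far] finite_subset unfolding cell_ok_def by blast
  then obtain z where z: "far k (lo ?c) z" "z \<prec> hi ?c" "val ?c z = None" by auto
  let ?d = "Cell ((val ?c)(z \<mapsto> True)) (lo ?c) z"
  have "cell_ok ?d" "refines ?d ?c"
    using c z far_less[OF z(1)] wo.less_imp_le[OF z(2)]
    by (auto simp: cell_ok_def refines_def map_le_def intro: wo.order_trans)
  then show "\<exists>d. cell_ok d \<and> refines d ?c \<and> far k (lo d) (hi d) \<and>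
      val d (hi d) = Some True \<and> hi d \<prec> hi ?c"
    using z by (intro exI[of _ ?d]) auto
qed (use that in blast)

section \<open>Forcing\<close>

text \<open>Disjunctions and existential quantifiers are forced outright, an existential by a single
  function of the index, while a universal quantifier asks only for density.\<close>

primrec forces :: "condition \<Rightarrow> (nat \<Rightarrow> nat \<Rightarrow> nat) \<Rightarrow> fm \<Rightarrow> bool" where
  "forces p e (Atom P ts) = (\<forall>n\<in>inds p. settles (val (cells p n)) (e n) (Atom P ts))"
| "forces p e (NAtom P ts) = (\<forall>n\<in>inds p. settles (val (cells p n)) (e n) (NAtom P ts))"
| "forces p e (InX t) = (\<forall>n\<in>inds p. settles (val (cells p n)) (e n) (InX t))"
| "forces p e (NotInX t) = (\<forall>n\<in>inds p. settles (val (cells p n)) (e n) (NotInX t))"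
| "forces p e (And A B) = (forces p e A \<and> forces p e B)"
| "forces p e (Or A B) = (forces p e A \<or> forces p e B)"
| "forces p e (Forall A) = (\<forall>f q. q \<sqsubseteq> p \<longrightarrow> (\<exists>r. r \<sqsubseteq> q \<and> forces r (push f e) A))"
| "forces p e (Exists A) = (\<exists>f. forces p (push f e) A)"

lemma forces_literal:
  "literal A \<Longrightarrow> forces p e A \<longleftrightarrow> (\<forall>n\<in>inds p. settles (val (cells p n)) (e n) A)"
  by (cases A) auto

lemma forces_mono: "forces p e A \<Longrightarrow> q \<sqsubseteq> p \<Longrightarrow> forces q e A"
proof (induction A arbitrary: p q e)
  case (Forall A)
  then show ?case using extends_trans unfolding forces.simps by blast
next
  case (Exists A)
  then show ?case unfolding forces.simps by blast
qed (auto intro: extends_settles dest: extends_inds)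

lemma forces_consistent_literal:
  assumes "literal A" "is_cond p" "forces p e A"
  shows "\<not> forces p e (neg A)"
proof
  assume neg: "forces p e (neg A)"
  obtain n where "n \<in> inds p" using extends_nonempty[OF extends_refl[OF assms(2)]] by blast
  then show False using assms neg settles_consistent[of "val (cells p n)" "e n" A]
    by (simp add: forces_literal)
qed

lemma forces_consistent: "is_cond p \<Longrightarrow> forces p e A \<Longrightarrow> \<not> forces p e (neg A)"
proof (induction A arbitrary: p e)
  case (Forall A)
  show ?case
  proof
    assume "forces p e (neg (Forall A))"
    then obtain f where f: "forces p (push f e) (neg A)" by auto
    obtain r where "r \<sqsubseteq> p" "forces r (push f e) A"
      using Forall.prems extends_refl by fastforce
    then show False using Forall.IH forces_mono[OF f] extends_is_cond by blast
  qed
next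
  case (Exists A)
  show ?case
  proof
    assume neg: "forces p e (neg (Exists A))"
    obtain f where f: "forces p (push f e) A" using Exists.prems by auto
    obtain r where "r \<sqsubseteq> p" "forces r (push f e) (neg A)"
      using neg Exists.prems extends_refl by fastforce
    then show False using Exists.IH forces_mono[OF f] extends_is_cond by blast
  qed
next
  case (And A B)
  then show ?case unfolding forces.simps neg.simps by blast
next
  case (Or A B)
  then show ?case unfolding forces.simps neg.simps by blast
qed (rule forces_consistent_literal; simp)+

text \<open>If no extension forces an existential, deciding its instances has the negative outcome
  densely, so \<open>p\<close> itself forces the negation. Literals are decided at each index and
  made uniform by splitting.\<close>

lemma forces_decides: "is_cond p \<Longrightarrow> \<exists>q. q \<sqsubseteq> p \<and> (forces q e A \<or> forces q e (neg A))"
proof (induction A arbitrary: p e rule: measure_induct_rule[where f = size])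
  case (less A)
  show ?case
  proof (cases "literal A")
    case True
    obtain q where q: "q \<sqsubseteq> p" "\<And>n. n \<in> inds q \<Longrightarrow>
        settles (val (cells q n)) (e n) A \<or> settles (val (cells q n)) (e n) (neg A)"
      using decide_formula[OF less.prems finitely_determined_literal[OF True]] by metis
    obtain r where r: "r \<sqsubseteq> q" "cells r = cells q"
      "(\<forall>n\<in>inds r. settles (val (cells q n)) (e n) A) \<or> (\<forall>n\<in>inds r. settles (val (cells q n)) (e n) (neg A))"
      by (rule split_cond[OF extends_is_cond[OF q(1)] q(2)])
    then have "forces r e A \<or> forces r e (neg A)" using True by (simp add: forces_literal)
    then show ?thesis using r(1) q(1) extends_trans by blast
  next
    case False
    have two: "\<exists>q. q \<sqsubseteq> p \<and> (forces q e B \<or> forces q e (neg B)) \<and> (forces q e C \<or> forces q e (neg C))"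
      if sz: "size B < size A" "size C < size A" for B C
    proof -
      obtain q where q: "q \<sqsubseteq> p" "forces q e B \<or> forces q e (neg B)"
        using less.IH[OF sz(1) less.prems] by blast
      obtain r where r: "r \<sqsubseteq> q" "forces r e C \<or> forces r e (neg C)"
        using less.IH[OF sz(2) extends_is_cond[OF q(1)]] by blast
      have "forces r e B \<or> forces r e (neg B)" using q(2) forces_mono[OF _ r(1)] by blast
      then show ?thesis using r(2) extends_trans[OF r(1) q(1)] by blast
    qed
    have quant: "\<exists>q. q \<sqsubseteq> p \<and> (forces q e (Exists B) \<or> forces q e (Forall (neg B)))"
      if IH: "\<And>p e. is_cond p \<Longrightarrow> \<exists>q. q \<sqsubseteq> p \<and> (forces q e B \<or> forces q e (neg B))" for B
    proof (cases "\<exists>q. q \<sqsubseteq> p \<and> forces q e (Exists B)")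
      case False
      have "\<exists>r. r \<sqsubseteq> q \<and> forces r (push f e) (neg B)" if q: "q \<sqsubseteq> p" for f q
      proof -
        obtain r where r: "r \<sqsubseteq> q" "forces r (push f e) B \<or> forces r (push f e) (neg B)"
          using IH[OF extends_is_cond[OF q]] by blast
        have "\<not> forces r (push f e) B"
          using False extends_trans[OF r(1) q] unfolding forces.simps(8) by blast
        then show ?thesis using r by blast
      qed
      then have "forces p e (Forall (neg B))" by simp
      then show ?thesis using extends_refl[OF less.prems] by blast
    qed blast
    show ?thesis
    proof (cases A)
      case (And B C)
      then show ?thesis using two[of B C] by auto
    next
      case (Or B C)
      then show ?thesis using two[of B C] by auto
    next
      case (Forall B)
      then have "\<And>p e. is_cond p \<Longrightarrow> \<exists>q. q \<sqsubseteq> p \<and> (forces q e B \<or> forces q e (neg B))"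
        by (intro less.IH) simp_all
      then have "\<exists>q. q \<sqsubseteq> p \<and> (forces q e (Exists (neg B)) \<or> forces q e (Forall (neg (neg B))))"
        by (intro quant) (simp add: disj_commute)
      then show ?thesis unfolding Forall neg.simps neg_neg by blast
    next
      case (Exists B)
      then have "\<And>p e. is_cond p \<Longrightarrow> \<exists>q. q \<sqsubseteq> p \<and> (forces q e B \<or> forces q e (neg B))"
        by (intro less.IH) simp_all
      then show ?thesis unfolding Exists neg.simps by (rule quant)
    qed (use False in auto)
  qed
qed

section \<open>Substitution and soundness of the sequent calculus\<close>

lemma forces_subst: "forces p e (subst s A) \<longleftrightarrow> forces p (\<lambda>n i. eval_tm (e n) (s i)) A"
proof (induction A arbitrary: p e s)
  case (Forall A)
  have "(\<lambda>n i. eval_tm (push f e n) (under_binder s i)) = push f (\<lambda>n i. eval_tm (e n) (s i))" for f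
    by (auto simp: fun_eq_iff under_binder_def split: nat.split)
  then show ?case using Forall by simp
next
  case (Exists A)
  have "(\<lambda>n i. eval_tm (push f e n) (under_binder s i)) = push f (\<lambda>n i. eval_tm (e n) (s i))" for f
    by (auto simp: fun_eq_iff under_binder_def split: nat.split)
  then show ?case using Exists by simp
qed (auto simp: settles_def eval_subst_tm comp_def)

lemma forces_lift: "forces p (push f e) (lift A) \<longleftrightarrow> forces p e A"
  by (simp add: lift_def forces_subst)

lemma forces_inst: "forces p e (inst A t) \<longleftrightarrow> forces p (push (\<lambda>n. eval_tm (e n) t) e) A"
proof -
  have "(\<lambda>n i. eval_tm (e n) (case_nat t Var i)) = push (\<lambda>n. eval_tm (e n) t) e"
    by (auto simp: fun_eq_iff split: nat.split)
  then show ?thesis by (simp add: inst_def forces_subst)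
qed

lemma literal_subst [simp]: "literal (subst s A) = literal A"
  by (cases A) auto

lemma settles_inst:
  "literal A \<Longrightarrow> settles \<rho> e (inst A t) \<longleftrightarrow> settles \<rho> (case_nat (eval_tm e t) e) A"
proof -
  have *: "(\<lambda>i. eval_tm e (case_nat t Var i)) = case_nat (eval_tm e t) e"
    by (auto simp: fun_eq_iff split: nat.split)
  assume "literal A"
  then show ?thesis by (cases A) (auto simp: inst_def settles_def eval_subst_tm comp_def *)
qed

text \<open>A sequent is read as density of the conditions that force a member, and the member may
  change with the extension. The two premises of a rule can then be used in succession; for cut,
  \<open>forces_consistent\<close> prevents both from yielding the cut formulas.\<close>

theorem soundness:
  assumes "T \<turnstile> \<Gamma>"
    and ax: "\<And>A p e. A \<in> T \<Longrightarrow> is_cond p \<Longrightarrow> \<exists>q. q \<sqsubseteq> p \<and> forces q e A"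
    and "is_cond p"
  shows "\<exists>q A. q \<sqsubseteq> p \<and> A \<in> \<Gamma> \<and> forces q e A"
  using assms(1,3)
proof (induction arbitrary: p e rule: derivable.induct)
  case (identity_rule \<Gamma> A)
  then show ?case using forces_decides by blast
next
  case (axiom_rule \<Gamma> A)
  then show ?case using ax by blast
next
  case (eq_refl_rule \<Gamma> t)
  have "forces p e (Atom eq_sym [t, t])" by (simp add: settles_def binary_psym_def)
  then show ?case using eq_refl_rule extends_refl by blast
next
  case (eq_subst_rule \<Gamma> A t u)
  obtain q where q: "q \<sqsubseteq> p" "forces q e (inst A t) \<or> forces q e (neg (inst A t))"
    using forces_decides[OF eq_subst_rule.prems] by blast
  obtain r where r: "r \<sqsubseteq> q" "forces r e (Atom eq_sym [t, u]) \<or> forces r e (NAtom eq_sym [t, u])"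
    using forces_decides[OF extends_is_cond[OF q(1)], of e "Atom eq_sym [t, u]"] by auto
  have lit: "literal (inst A s)" for s using eq_subst_rule by (simp add: inst_def)
  have "forces r e (inst A u)" if "forces q e (inst A t)" "forces r e (Atom eq_sym [t, u])"
  proof -
    have "eval_tm (e n) t = eval_tm (e n) u" if "n \<in> inds r" for n
      using \<open>forces r e (Atom eq_sym [t, u])\<close> that agrees_ones
      by (fastforce simp: settles_def binary_psym_def)
    moreover have "forces r e (inst A t)" using forces_mono[OF that(1) r(1)] .
    ultimately show ?thesis
      using eq_subst_rule.hyps(2) by (simp add: forces_literal lit settles_inst)
  qed
  then show ?case using q r eq_subst_rule.hyps forces_mono[of q e _ r] extends_trans by metis
next
  case (and_rule A \<Gamma> B)
  obtain q C where q: "q \<sqsubseteq> p" "C \<in> insert A \<Gamma>" "forces q e C" using and_rule by blast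
  obtain r D where r: "r \<sqsubseteq> q" "D \<in> insert B \<Gamma>" "forces r e D"
    using and_rule.IH(2)[OF extends_is_cond[OF q(1)]] by blast
  have "forces r e C" "r \<sqsubseteq> p" using forces_mono q r extends_trans by blast+
  then show ?case using q(2) r(2,3) by (metis forces.simps(5) insert_iff)
next
  case (or_rule A B \<Gamma>)
  then show ?case by (metis forces.simps(6) insert_iff)
next
  case (forall_rule A \<Gamma>)
  show ?case
  proof (cases "\<exists>q C. q \<sqsubseteq> p \<and> C \<in> \<Gamma> \<and> forces q e C")
    case False
    \<comment> \<open>No extension of \<open>p\<close> forces a side formula, so the premise can
      only deliver \<open>A\<close>, whatever element is pushed.\<close>
    have "\<exists>r. r \<sqsubseteq> q \<and> forces r (push f e) A" if q: "q \<sqsubseteq> p" for f q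
    proof -
      obtain r C where r: "r \<sqsubseteq> q" "C \<in> insert A (lift ` \<Gamma>)" "forces r (push f e) C"
        using forall_rule.IH[OF extends_is_cond[OF q]] by blast
      moreover have "C \<notin> lift ` \<Gamma>" using False r q extends_trans by (fastforce simp: forces_lift)
      ultimately show ?thesis by blast
    qed
    then have "forces p e (Forall A)" by simp
    then show ?thesis using extends_refl[OF forall_rule.prems] by blast
  qed blast
next
  case (exists_rule A t \<Gamma>)
  then obtain q C where q: "q \<sqsubseteq> p" "C \<in> insert (inst A t) \<Gamma>" "forces q e C" by blast
  show ?case
  proof (cases "C = inst A t")
    case True
    then have "forces q (push (\<lambda>n. eval_tm (e n) t) e) A" using q(3) by (simp only: forces_inst)
    then have "forces q e (Exists A)" unfolding forces.simps(8) by blast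
    then show ?thesis using q(1) by blast
  qed (use q in blast)
next
  case (cut_rule A \<Gamma>)
  obtain q C where q: "q \<sqsubseteq> p" "C \<in> insert A \<Gamma>" "forces q e C" using cut_rule by blast
  obtain r D where r: "r \<sqsubseteq> q" "D \<in> insert (neg A) \<Gamma>" "forces r e D"
    using cut_rule.IH(2)[OF extends_is_cond[OF q(1)]] by blast
  have "forces r e C" "r \<sqsubseteq> p" using forces_mono q r extends_trans by blast+
  then show ?case using q(2) r(2,3) forces_consistent[OF extends_is_cond[OF r(1)]] by (metis insert_iff)
qed

section \<open>True sentences\<close>

text \<open>As in the theorem of Los, witnesses are collected index by index into a function; a
  disjunction is handled by splitting the index set. Without \<open>X\<close> in the formula, the
  empty set serves as well as any other.\<close>

lemma true_forced:
  assumes "X_free A" "is_cond p" "\<And>n. n \<in> inds p \<Longrightarrow> holds {} (e n) A"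
  shows "\<exists>q. q \<sqsubseteq> p \<and> forces q e A"
  using assms
proof (induction A arbitrary: p e)
  case (Atom P ts)
  then show ?case using extends_refl by (fastforce simp: settles_def)
next
  case (NAtom P ts)
  then show ?case using extends_refl by (fastforce simp: settles_def)
next
  case (And A B)
  obtain q where q: "q \<sqsubseteq> p" "forces q e A" using And.IH(1)[OF _ And.prems(2)] And.prems by auto
  have "holds {} (e n) B" if "n \<in> inds q" for n using And.prems(3) q(1) that by (auto simp: extends_def)
  then obtain r where "r \<sqsubseteq> q" "forces r e B"
    using And.IH(2)[OF _ extends_is_cond[OF q(1)]] And.prems(1) by auto
  then show ?case using q extends_trans forces_mono by (meson forces.simps(5))
next
  case (Or A B)
  have "holds {} (e n) A \<or> holds {} (e n) B" if "n \<in> inds p" for n using Or.prems(3)[OF that] by simp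
  then obtain q where q: "q \<sqsubseteq> p" "(\<forall>n\<in>inds q. holds {} (e n) A) \<or> (\<forall>n\<in>inds q. holds {} (e n) B)"
    using split_cond[OF Or.prems(2), of "\<lambda>n. holds {} (e n) A" "\<lambda>n. holds {} (e n) B"] by blast
  then obtain r where "r \<sqsubseteq> q" "forces r e A \<or> forces r e B"
    using Or.IH[OF _ extends_is_cond[OF q(1)]] Or.prems(1) by (metis X_free.simps(6))
  then show ?case using extends_trans[OF _ q(1)] by auto
next
  case (Forall A)
  have "\<exists>r. r \<sqsubseteq> q \<and> forces r (push f e) A" if q: "q \<sqsubseteq> p" for f q
    using Forall.prems(1,3) q by (intro Forall.IH extends_is_cond[OF q]) (auto simp: extends_def)
  then show ?case using extends_refl[OF Forall.prems(2)] by auto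
next
  case (Exists A)
  have "\<forall>n. \<exists>x. n \<in> inds p \<longrightarrow> holds {} (case_nat x (e n)) A" using Exists.prems(3) by auto
  then obtain f where f: "\<And>n. n \<in> inds p \<Longrightarrow> holds {} (push f e n) A"
    unfolding push_apply by metis
  have "\<exists>q. q \<sqsubseteq> p \<and> forces q (push f e) A"
    by (rule Exists.IH[OF _ Exists.prems(2) f]) (use Exists.prems(1) in simp_all)
  then show ?case by auto
qed auto

section \<open>Induction\<close>

text \<open>A settled disjunction need not settle a disjunct. Once \<open>A\<close> is decided at
  every index, one of the two is settled there, and splitting makes the choice uniform.\<close>

lemma settled_Or_forced:
  assumes A: "finitely_determined A"
    "\<And>p. is_cond p \<Longrightarrow> (\<And>n. n \<in> inds p \<Longrightarrow> settles (val (cells p n)) (e n) A) \<Longrightarrow>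
       \<exists>q. q \<sqsubseteq> p \<and> forces q e A"
    and B: "\<And>p. is_cond p \<Longrightarrow> (\<And>n. n \<in> inds p \<Longrightarrow> settles (val (cells p n)) (e n) B) \<Longrightarrow>
       \<exists>q. q \<sqsubseteq> p \<and> forces q e B"
    and p: "is_cond p" "\<And>n. n \<in> inds p \<Longrightarrow> settles (val (cells p n)) (e n) (Or A B)"
  shows "\<exists>q. q \<sqsubseteq> p \<and> forces q e (Or A B)"
proof -
  obtain q where q: "q \<sqsubseteq> p" "\<And>n. n \<in> inds q \<Longrightarrow>
      settles (val (cells q n)) (e n) A \<or> settles (val (cells q n)) (e n) (neg A)"
    using decide_formula[OF p(1) A(1)] by metis
  have "settles (val (cells q n)) (e n) A \<or> settles (val (cells q n)) (e n) B" if n: "n \<in> inds q" for n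
  proof -
    have "n \<in> inds p" using q(1) n by (auto simp: extends_def)
    then have "settles (val (cells q n)) (e n) (Or A B)"
      using extends_settles[OF q(1) n] p(2) by blast
    then show ?thesis using q(2)[OF n] by (auto simp: settles_def)
  qed
  then obtain r where r: "r \<sqsubseteq> q" "cells r = cells q"
    "(\<forall>n\<in>inds r. settles (val (cells q n)) (e n) A) \<or> (\<forall>n\<in>inds r. settles (val (cells q n)) (e n) B)"
    using split_cond[OF extends_is_cond[OF q(1)],
        of "\<lambda>n. settles (val (cells q n)) (e n) A" "\<lambda>n. settles (val (cells q n)) (e n) B"] by blast
  then have "\<exists>s. s \<sqsubseteq> r \<and> (forces s e A \<or> forces s e B)"
    using A(2)[of r] B[of r] extends_is_cond[OF r(1)] by auto
  then show ?thesis using r(1) q(1) extends_trans by (metis forces.simps(6))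
qed

lemma settled_forced:
  assumes "Delta0_X A" "is_cond p" "\<And>n. n \<in> inds p \<Longrightarrow> settles (val (cells p n)) (e n) A"
  shows "\<exists>q. q \<sqsubseteq> p \<and> forces q e A"
  using assms
proof (induction arbitrary: p e rule: Delta0_X.induct)
  case (1 A)
  then show ?case using extends_refl forces_literal by blast
next
  case (2 A B)
  have "settles \<rho> e (And A B) \<longleftrightarrow> settles \<rho> e A \<and> settles \<rho> e B" for \<rho> e by (auto simp: settles_def)
  then have st: "\<And>n. n \<in> inds p \<Longrightarrow> settles (val (cells p n)) (e n) A"
    "\<And>n. n \<in> inds p \<Longrightarrow> settles (val (cells p n)) (e n) B"
    using 2 by blast+
  obtain q where q: "q \<sqsubseteq> p" "forces q e A" using 2 st by blast
  have "settles (val (cells q n)) (e n) B" if "n \<in> inds q" for n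
    using extends_settles[OF q(1) that] st(2) q(1) that by (auto simp: extends_def)
  then obtain r where "r \<sqsubseteq> q" "forces r e B" using 2 extends_is_cond[OF q(1)] by blast
  then show ?case using q extends_trans forces_mono by (meson forces.simps(5))
next
  case (3 A B)
  show ?case
    by (rule settled_Or_forced[OF finitely_determined_Delta0[OF 3(1)] 3(3) 3(4) 3(5,6)])
next
  case (4 A t)
  let ?N = "NAtom le_sym [Var 0, lift_tm t]"
  have "\<exists>r. r \<sqsubseteq> q \<and> forces r (push f e) (Or ?N A)" if q: "q \<sqsubseteq> p" for f q
  proof (rule settled_Or_forced[OF finitely_determined_literal _ _ extends_is_cond[OF q]])
    show "literal ?N" by simp
    show "\<exists>s. s \<sqsubseteq> r \<and> forces s (push f e) ?N" if "is_cond r"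
      "\<And>n. n \<in> inds r \<Longrightarrow> settles (val (cells r n)) (push f e n) ?N" for r
      using that extends_refl by auto
    show "\<exists>s. s \<sqsubseteq> r \<and> forces s (push f e) A" if "is_cond r"
      "\<And>n. n \<in> inds r \<Longrightarrow> settles (val (cells r n)) (push f e n) A" for r
      using that by (rule "4.IH")
    fix n assume n: "n \<in> inds q"
    then have "n \<in> inds p" using q by (auto simp: extends_def)
    then have "settles (val (cells q n)) (e n) (Forall (Or ?N A))"
      using extends_settles[OF q n] 4 by blast
    then show "settles (val (cells q n)) (push f e n) (Or ?N A)" by (auto simp: settles_def)
  qed
  then have "forces p e (Forall (Or ?N A))" by simp
  then show ?case using extends_refl[OF 4(4)] by blast
next
  case (5 A t)
  let ?L = "Atom le_sym [Var 0, lift_tm t]"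
  have "\<forall>n. \<exists>F. finite F \<and> (\<forall>X Y x. X \<inter> F = Y \<inter> F \<longrightarrow> x \<le> eval_tm (e n) t \<longrightarrow>
      holds X (case_nat x (e n)) A = holds Y (case_nat x (e n)) A)"
    using finitely_determined_bounded[OF finitely_determined_Delta0[OF 5(1)]] by metis
  then obtain F where F: "\<And>n. finite (F n)"
    "\<And>n X Y x. X \<inter> F n = Y \<inter> F n \<Longrightarrow> x \<le> eval_tm (e n) t \<Longrightarrow>
      holds X (case_nat x (e n)) A = holds Y (case_nat x (e n)) A"
    by metis
  \<comment> \<open>A witness may depend on undecided values of \<open>X\<close>. All values
    relevant below the bound are decided first, so that one witness serves every completion.\<close>
  obtain q where q: "q \<sqsubseteq> p" "\<And>n. n \<in> inds q \<Longrightarrow> F n \<subseteq> dom (val (cells q n))"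
    using decide_points[where F = F, OF 5(4) F(1)] by blast
  have "\<exists>x. settles (val (cells q n)) (case_nat x (e n)) ?L \<and> settles (val (cells q n)) (case_nat x (e n)) A"
    if n: "n \<in> inds q" for n
  proof -
    have "n \<in> inds p" using q(1) n by (auto simp: extends_def)
    then have "settles (val (cells q n)) (e n) (Exists (And ?L A))"
      using extends_settles[OF q(1) n] 5 by blast
    then obtain x where x: "x \<le> eval_tm (e n) t"
      "holds {y. val (cells q n) y = Some True} (case_nat x (e n)) A"
      using agrees_ones holds_bounded_Exists unfolding settles_def by blast
    have "holds X (case_nat x (e n)) A" if "agrees X (val (cells q n))" for X
      using F(2)[OF agrees_Int[OF that agrees_ones q(2)[OF n]] x(1)] x(2) by simp
    then show ?thesis using x(1) by (auto simp: settles_def binary_psym_def)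
  qed
  then obtain f where f: "\<And>n. n \<in> inds q \<Longrightarrow> settles (val (cells q n)) (push f e n) ?L"
    "\<And>n. n \<in> inds q \<Longrightarrow> settles (val (cells q n)) (push f e n) A"
    unfolding push_apply by metis
  obtain r where r: "r \<sqsubseteq> q" "forces r (push f e) A"
    using "5.IH"[OF extends_is_cond[OF q(1)] f(2)] by blast
  have "forces q (push f e) ?L" unfolding forces.simps using f(1) by blast
  then have "forces r (push f e) ?L" using r(1) by (rule forces_mono)
  then have "forces r (push f e) (And ?L A)" unfolding forces.simps(5) using r(2) by blast
  then have "forces r e (Exists (And ?L A))" by (simp only: forces.simps) blast
  then show ?case using r(1) q(1) extends_trans by blast
qed

text \<open>After deciding \<open>A\<close> and splitting, the negative outcome would let
  \<open>settled_forced\<close> force \<open>neg A\<close> below a condition that forces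
  \<open>A\<close>.\<close>

lemma forced_settled:
  assumes A: "Delta0_X A" and p: "is_cond p" "forces p e A"
  shows "\<exists>q. q \<sqsubseteq> p \<and> (\<forall>n\<in>inds q. settles (val (cells q n)) (e n) A)"
proof -
  obtain q where q: "q \<sqsubseteq> p" "\<And>n. n \<in> inds q \<Longrightarrow>
      settles (val (cells q n)) (e n) A \<or> settles (val (cells q n)) (e n) (neg A)"
    using decide_formula[OF p(1) finitely_determined_Delta0[OF A]] by metis
  obtain r where r: "r \<sqsubseteq> q" "cells r = cells q"
    "(\<forall>n\<in>inds r. settles (val (cells q n)) (e n) A) \<or> (\<forall>n\<in>inds r. settles (val (cells q n)) (e n) (neg A))"
    by (rule split_cond[OF extends_is_cond[OF q(1)] q(2)])
  have "\<not> (\<forall>n\<in>inds r. settles (val (cells r n)) (e n) (neg A))"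
  proof
    assume "\<forall>n\<in>inds r. settles (val (cells r n)) (e n) (neg A)"
    then obtain s where s: "s \<sqsubseteq> r" "forces s e (neg A)"
      using settled_forced[OF Delta0_X_neg[OF A] extends_is_cond[OF r(1)]] by blast
    then have "forces s e A" using forces_mono[OF p(2)] extends_trans r(1) q(1) by blast
    then show False using s forces_consistent extends_is_cond by blast
  qed
  then show ?thesis using r q(1) extends_trans by metis
qed

text \<open>
  The \<open>b\<close> intervals into which a long one splits pay for \<open>b\<close> induction steps. If no step
  from \<open>x\<close> to \<open>x + 1\<close> is possible at the price of one interval, retreating to the topmost
  interval excludes \<open>x + 1\<close> for good: a refinement that achieves it would leave the rest unspent.
\<close>

lemma cell_induction:
  assumes c: "cell_ok c" and far: "far (Suc k) (lo c) (hi c)" and start: "\<Phi> (val c) (0::nat)"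
  shows "\<exists>d. cell_ok d \<and> refines d c \<and> far k (lo d) (hi d) \<and>
    (\<Phi> (val d) b \<or> (\<exists>x. \<Phi> (val d) x \<and> (\<forall>d'. cell_ok d' \<longrightarrow> refines d' d \<longrightarrow> \<not> \<Phi> (val d') (Suc x))))"
proof -
  \<comment> \<open>When \<open>x\<close> is reached, \<open>b - x + 1\<close> intervals above the
    original \<open>lo\<close> must still be unspent.\<close>
  define Q where "Q x \<longleftrightarrow> (\<exists>d. cell_ok d \<and> refines d c \<and> lo d = lo c \<and>
    (far k ^^ Suc (b - x)) (lo c) (hi d) \<and> \<Phi> (val d) x)" for x
  have "Q 0" unfolding Q_def using c refines_refl far_SucD[OF far] start by blast
  have "Q b \<or> (\<exists>x<b. Q x \<and> \<not> Q (Suc x))"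
  proof (rule ccontr)
    assume *: "\<not> ?thesis"
    have "Q x" if "x \<le> b" for x
      using that by (induction x) (use \<open>Q 0\<close> * in auto)
    then show False using * by blast
  qed
  then show ?thesis
  proof
    assume "Q b"
    then obtain d where "cell_ok d" "refines d c" "lo d = lo c" "(far k ^^ Suc 0) (lo c) (hi d)" "\<Phi> (val d) b"
      unfolding Q_def by auto
    then show ?thesis using chain_far by metis
  next
    assume "\<exists>x<b. Q x \<and> \<not> Q (Suc x)"
    then obtain x where x: "x < b" "Q x" "\<not> Q (Suc x)" by blast
    then obtain d where d: "cell_ok d" "refines d c" "lo d = lo c"
      "(far k ^^ Suc (b - x)) (lo c) (hi d)" "\<Phi> (val d) x"
      unfolding Q_def by blast
    have "b - x = Suc (b - Suc x)" using x(1) by simp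
    then obtain w where w: "(far k ^^ Suc (b - Suc x)) (lo c) w" "far k w (hi d)"
      using relpowp_Suc_E[OF d(4)] by metis
    note less = far_less[OF chain_far[OF w(1)]] far_less[OF w(2)]
    \<comment> \<open>Raising \<open>lo\<close> to \<open>w\<close> keeps the topmost interval only;
      those below are set aside for a possible next step.\<close>
    let ?d = "Cell (val d) w (hi d)"
    have "\<not> \<Phi> (val d') (Suc x)" if d': "cell_ok d'" "refines d' ?d" for d'
    proof
      assume \<Phi>: "\<Phi> (val d') (Suc x)"
      have w_hi: "w \<prec> hi d'" using d' by (auto simp: cell_ok_def refines_def dest: wo.le_less_trans)
      \<comment> \<open>All ones of \<open>d'\<close> lie above \<open>w\<close>, so the intervals
        set aside can be restored beneath them.\<close>
      have "cell_ok (Cell (val d') (lo c) w)"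
        using d' less w_hi by (auto simp: cell_ok_def intro: wo.less_imp_le wo.order_trans)
      moreover have "refines (Cell (val d') (lo c) w) c"
        using d' d(2) wo.less_imp_le[OF less(2)]
        by (auto simp: refines_def intro: map_le_trans wo.order_trans)
      ultimately have "Q (Suc x)" unfolding Q_def using w(1) \<Phi> by (metis cell.sel)
      then show False using x(3) by blast
    qed
    moreover have "cell_ok ?d" using d(1) less by (simp add: cell_ok_def)
    moreover have "refines ?d c"
      using d(2) wo.less_imp_le[OF less(1)] by (simp add: refines_def)
    ultimately show ?thesis using w(2) d(5) by (intro exI[of _ ?d]) auto
  qed
qed

text \<open>The function \<open>f\<close> is an arbitrary, possibly nonstandard, number. At each
  index \<open>cell_induction\<close> either reaches \<open>f n\<close> or stops at some
  \<open>g n\<close> whose successor no refinement of the cell can reach; splitting makes the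
  alternative uniform.\<close>

lemma Sigma1_induction_forced:
  assumes B: "Delta0_X B" and p: "is_cond p" and start: "forces p (push (\<lambda>_. 0) e) (Exists B)"
  shows "\<exists>q. q \<sqsubseteq> p \<and> (forces q (push f e) (Exists B) \<or>
    (\<exists>g. forces q (push g e) (Exists B) \<and> forces q (push (\<lambda>n. Suc (g n)) e) (neg (Exists B))))"
proof -
  define \<Phi> where "\<Phi> n \<rho> x \<longleftrightarrow> (\<exists>y. settles \<rho> (case_nat y (case_nat x (e n))) B)" for n \<rho> x
  have reach: "\<exists>r. r \<sqsubseteq> q \<and> forces r (push g e) (Exists B)"
    if "is_cond q" "\<forall>n\<in>inds q. \<Phi> n (val (cells q n)) (g n)" for q g
  proof -
    have "\<forall>n. \<exists>y. n \<in> inds q \<longrightarrow> settles (val (cells q n)) (case_nat y (case_nat (g n) (e n))) B"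
      using that(2) unfolding \<Phi>_def by blast
    then obtain y where "\<And>n. n \<in> inds q \<Longrightarrow> settles (val (cells q n)) (push y (push g e) n) B"
      unfolding push_apply by metis
    then show ?thesis using settled_forced[OF B that(1)] by (metis forces.simps(8))
  qed
  obtain y where "forces p (push y (push (\<lambda>_. 0) e)) B" using start by auto
  then obtain p' where p': "p' \<sqsubseteq> p"
    "\<And>n. n \<in> inds p' \<Longrightarrow> settles (val (cells p' n)) (push y (push (\<lambda>_. 0) e) n) B"
    using forced_settled[OF B p] by blast
  have start': "\<Phi> n (val (cells p' n)) 0" if "n \<in> inds p'" for n
    using p'(2)[OF that] by (auto simp: \<Phi>_def)
  define stuck where "stuck n d x \<longleftrightarrow> \<Phi> n (val d) x \<and>
    (\<forall>d'. cell_ok d' \<longrightarrow> refines d' d \<longrightarrow> \<not> \<Phi> n (val d') (Suc x))" for n d x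
  have "\<exists>d. cell_ok d \<and> refines d (cells p' n) \<and> far k (lo d) (hi d) \<and>
      (\<Phi> n (val d) (f n) \<or> (\<exists>x. stuck n d x))"
    if n: "n \<in> inds p'" and far: "far (Suc k) (lo (cells p' n)) (hi (cells p' n))" for n k
    unfolding stuck_def
  proof (rule cell_induction[OF _ far, of "\<Phi> n"])
    show "cell_ok (cells p' n)" using extends_is_cond[OF p'(1)] n by (simp add: is_cond_def)
    show "\<Phi> n (val (cells p' n)) 0" by (rule start'[OF n])
  qed
  then obtain q where q: "q \<sqsubseteq> p'"
    "\<And>n. n \<in> inds q \<Longrightarrow> \<Phi> n (val (cells q n)) (f n) \<or> (\<exists>x. stuck n (cells q n) x)"
    using refine_cond[OF extends_is_cond[OF p'(1)],
        of "\<lambda>n d. \<Phi> n (val d) (f n) \<or> (\<exists>x. stuck n d x)"] by blast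
  obtain r where r: "r \<sqsubseteq> q" "cells r = cells q"
    "(\<forall>n\<in>inds r. \<Phi> n (val (cells q n)) (f n)) \<or> (\<forall>n\<in>inds r. \<exists>x. stuck n (cells q n) x)"
    by (rule split_cond[OF extends_is_cond[OF q(1)] q(2)])
  have rp: "r \<sqsubseteq> p" using r(1) q(1) p'(1) extends_trans by blast
  note r_cond = extends_is_cond[OF rp]
  from r(3) show ?thesis
  proof
    assume "\<forall>n\<in>inds r. \<Phi> n (val (cells q n)) (f n)"
    then show ?thesis using reach[OF r_cond, of f] r(2) rp extends_trans by metis
  next
    assume "\<forall>n\<in>inds r. \<exists>x. stuck n (cells q n) x"
    then obtain g where g: "\<And>n. n \<in> inds r \<Longrightarrow> stuck n (cells r n) (g n)" using r(2) by metis
    obtain s where s: "s \<sqsubseteq> r" "forces s (push g e) (Exists B)"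
      using reach[OF r_cond, of g] g unfolding stuck_def by blast
    \<comment> \<open>Refinements of a stuck cell settle \<open>B\<close> for no \<open>y\<close>,
      so deciding \<open>B\<close> can only give \<open>neg B\<close>. This excludes witnesses of an
      unbounded quantifier.\<close>
    have "\<exists>t'. t' \<sqsubseteq> t \<and> forces t' (push y (push (\<lambda>n. Suc (g n)) e)) (neg B)" if t: "t \<sqsubseteq> s" for y t
    proof -
      let ?e = "push y (push (\<lambda>n. Suc (g n)) e)"
      obtain u where u: "u \<sqsubseteq> t" "\<And>n. n \<in> inds u \<Longrightarrow>
          settles (val (cells u n)) (?e n) B \<or> settles (val (cells u n)) (?e n) (neg B)"
        using decide_formula[OF extends_is_cond[OF t] finitely_determined_Delta0[OF B], of ?e] by metis
      have ur: "u \<sqsubseteq> r" using u(1) t s(1) extends_trans by blast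
      have "\<not> settles (val (cells u n)) (?e n) B" if n: "n \<in> inds u" for n
      proof -
        have "stuck n (cells r n) (g n)" "cell_ok (cells u n)" "refines (cells u n) (cells r n)"
          using ur n g by (auto simp: extends_def is_cond_def)
        then have "\<not> \<Phi> n (val (cells u n)) (Suc (g n))" unfolding stuck_def by blast
        then show ?thesis unfolding \<Phi>_def push_apply by blast
      qed
      then have "\<And>n. n \<in> inds u \<Longrightarrow> settles (val (cells u n)) (?e n) (neg B)" using u(2) by blast
      then show ?thesis
        using settled_forced[OF Delta0_X_neg[OF B] extends_is_cond[OF u(1)]] u(1) extends_trans by blast
    qed
    then have "forces s (push (\<lambda>n. Suc (g n)) e) (neg (Exists B))" by simp
    then show ?thesis using s rp extends_trans by blast
  qed
qed

text \<open>If no extension forced the axiom, some extension would force \<open>A\<close> at 0 and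
  have an element \<open>f\<close> at which \<open>A\<close> is never forced below it, and no
  extension would force a failing step. \<open>Sigma1_induction_forced\<close> produces such a
  step.\<close>

lemma induction_axiom_forced:
  assumes A: "pSigma_X 1 A" and p: "is_cond p"
  shows "\<exists>q. q \<sqsubseteq> p \<and> forces q e (induction_axiom A)"
proof (rule ccontr)
  assume none: "\<not> ?thesis"
  obtain B where B: "A = Exists B" "Delta0_X B"
    using A by (auto elim: pSigma_X.cases pPi_X.cases)
  let ?step = "imp A (subst (case_nat (succ_tm (Var 0)) (\<lambda>n. Var (Suc n))) A)"
  have "(\<lambda>n i. eval_tm (push g e n) (case_nat (succ_tm (Var 0)) (\<lambda>n. Var (Suc n)) i)) =
      push (\<lambda>n. Suc (g n)) e" for g
    by (auto simp: fun_eq_iff split: nat.split)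
  then have step: "forces q (push g e) (neg ?step) \<longleftrightarrow>
      forces q (push g e) A \<and> forces q (push (\<lambda>n. Suc (g n)) e) (neg A)" for q g
    by (simp add: imp_def neg_subst forces_subst del: push_apply)
  have no0: "\<not> forces q e (neg (inst A zero_tm))" and nostep: "\<not> forces q (push g e) (neg ?step)"
    and noall: "\<not> forces q e (Forall A)" if "q \<sqsubseteq> p" for q g
    using none that unfolding induction_axiom_def imp_def[of "And _ _"] by auto
  obtain q where q: "q \<sqsubseteq> p" "forces q e (inst A zero_tm)"
    using forces_decides[OF p] no0 by blast
  obtain f r where f: "r \<sqsubseteq> q" "\<And>s. s \<sqsubseteq> r \<Longrightarrow> \<not> forces s (push f e) A"
    using noall[OF q(1)] by auto
  have "forces r (push (\<lambda>_. 0) e) (Exists B)"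
    using forces_mono[OF q(2) f(1)] by (simp only: forces_inst eval_zero_tm B(1))
  from Sigma1_induction_forced[OF B(2) extends_is_cond[OF f(1)] this, of f]
  obtain s g where s: "s \<sqsubseteq> r"
    "forces s (push g e) A" "forces s (push (\<lambda>n. Suc (g n)) e) (neg A)"
    using f(2) unfolding B(1) by blast
  then show False using nostep[of s g] step f(1) q(1) extends_trans by blast
qed

section \<open>Transfinite induction\<close>

text \<open>The ones at \<open>hi\<close> refute that \<open>X\<close> is empty. A candidate
  \<open>g\<close> for the least element is itself a one, so lies at or above \<open>hi\<close>, and
  \<open>add_one\<close> supplies a smaller one.\<close>

lemma TI_not_forced:
  assumes p: "is_cond p" and one: "\<And>n. n \<in> inds p \<Longrightarrow> val (cells p n) (hi (cells p n)) = Some True"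
  shows "\<not> forces p e (TI (\<prec>))"
proof
  assume "forces p e (TI (\<prec>))"
  then consider "forces p e (Forall (NotInX (Var 0)))"
    | "forces p e (Exists (Forall (And (InX (Var 1))
           (Or (NotInX (Var 0)) (NAtom (binary_psym (\<prec>)) [Var 0, Var 1])))))"
    unfolding TI_def by auto
  then show False
  proof cases
    case 1
    then obtain q where q: "q \<sqsubseteq> p" "forces q (push (\<lambda>n. hi (cells p n)) e) (NotInX (Var 0))"
      using extends_refl[OF p] unfolding forces.simps(7) by blast
    obtain n where n: "n \<in> inds q" "n \<in> inds p" using extends_nonempty[OF q(1)] by blast
    then have "val (cells q n) (hi (cells p n)) = Some True"
      using one[of n] q(1) unfolding extends_def refines_def map_le_def by (metis domI)
    then show False using q(2) n settles_NotInX by fastforce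
  next
    case 2
    then obtain g where g: "\<And>f q. q \<sqsubseteq> p \<Longrightarrow> \<exists>r. r \<sqsubseteq> q \<and> forces r (push f (push g e)) (InX (Var 1)) \<and>
        forces r (push f (push g e)) (Or (NotInX (Var 0)) (NAtom (binary_psym (\<prec>)) [Var 0, Var 1]))"
      unfolding forces.simps(5,7,8) by blast
    \<comment> \<open>Any \<open>f\<close> will do, since \<open>InX (Var 1)\<close> speaks of
      \<open>g\<close> only.\<close>
    obtain r f where r: "r \<sqsubseteq> p" "forces r (push f (push g e)) (InX (Var 1))"
      using g[OF extends_refl[OF p]] by blast
    obtain q where q: "q \<sqsubseteq> r" "\<And>n. n \<in> inds q \<Longrightarrow>
        val (cells q n) (hi (cells q n)) = Some True \<and> hi (cells q n) \<prec> hi (cells r n)"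
      using add_one[OF extends_is_cond[OF r(1)]] by blast
    let ?f = "\<lambda>n. hi (cells q n)"
    obtain s where s: "s \<sqsubseteq> q" "forces s (push ?f (push g e))
        (Or (NotInX (Var 0)) (NAtom (binary_psym (\<prec>)) [Var 0, Var 1]))"
      using g[OF extends_trans[OF q(1) r(1)]] by blast
    obtain n where n: "n \<in> inds s" "n \<in> inds q" using extends_nonempty[OF s(1)] by blast
    then have nr: "n \<in> inds r" using q(1) by (auto simp: extends_def)
    have "val (cells r n) (g n) = Some True"
      using r(2) nr settles_InX by fastforce
    then have "hi (cells r n) \<preceq> g n"
      using extends_is_cond[OF r(1)] nr by (auto simp: is_cond_def cell_ok_def)
    then have less: "?f n \<prec> g n" using q(2)[OF n(2)] wo.less_le_trans by blast
    have "val (cells s n) (?f n) = Some True"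
      using q(2)[OF n(2)] s(1) n(1) unfolding extends_def refines_def map_le_def by (metis domI)
    then have "\<not> forces s (push ?f (push g e)) (NotInX (Var 0))"
      using n(1) settles_NotInX by fastforce
    moreover have "\<not> forces s (push ?f (push g e)) (NAtom (binary_psym (\<prec>)) [Var 0, Var 1])"
      using n(1) less agrees_ones by (fastforce simp: settles_def binary_psym_def)
    ultimately show False using s(2) by auto
  qed
qed

theorem TI_not_provable:
  assumes "\<And>h. \<exists>x y. far h x y"
  shows "\<not> provable (ISigma_X 1) (TI (\<prec>))"
proof
  assume "provable (ISigma_X 1) (TI (\<prec>))"
  then have prov: "ISigma_X 1 \<turnstile> {TI (\<prec>)}" by (simp add: provable_def)
  obtain x y where xy: "\<And>h. far h (x h) (y h)" using assms by metis
  \<comment> \<open>Index \<open>n\<close> receives an interval of length at least omega^n whose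
    upper end is the first one.\<close>
  define p :: condition where "p = Cond UNIV (\<lambda>n. Cell [y n \<mapsto> True] (x n) (y n))"
  have "finite {n. \<not> far k (x n) (y n)}" for k
  proof (rule finite_subset)
    show "{n. \<not> far k (x n) (y n)} \<subseteq> {..<k}" using far_antimono[OF xy] by (auto simp: not_less[symmetric])
  qed simp
  then have p: "is_cond p"
    using far_less[OF xy] by (auto simp: is_cond_def p_def cell_ok_def)
  have ax: "\<exists>q. q \<sqsubseteq> p \<and> forces q e A" if A: "A \<in> ISigma_X 1" and p: "is_cond p" for A p e
  proof (cases "A \<in> Th_N")
    case True
    then have "X_free A" "\<And>n. holds {} (e n) A" by (auto simp: Th_N_def pSigma_def)
    then show ?thesis using true_forced p by blast
  next
    case False
    then show ?thesis using A p induction_axiom_forced by (auto simp: ISigma_X_def)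
  qed
  have "\<exists>q A. q \<sqsubseteq> p \<and> A \<in> {TI (\<prec>)} \<and> forces q (\<lambda>_ _. 0) A"
    by (rule soundness[OF prov ax p])
  then obtain q where q: "q \<sqsubseteq> p" "forces q (\<lambda>_ _. 0) (TI (\<prec>))"
    by auto
  \<comment> \<open>Passing to \<open>q\<close> may have moved \<open>hi\<close> strictly below all
    ones; a fresh one restores the hypothesis of \<open>TI_not_forced\<close>.\<close>
  obtain r where r: "r \<sqsubseteq> q" "\<And>n. n \<in> inds r \<Longrightarrow>
      val (cells r n) (hi (cells r n)) = Some True \<and> hi (cells r n) \<prec> hi (cells q n)"
    using add_one[OF extends_is_cond[OF q(1)]] by blast
  then have "\<not> forces r (\<lambda>_ _. 0) (TI (\<prec>))"
    by (intro TI_not_forced extends_is_cond[OF r(1)]) simp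
  then show False using forces_mono[OF q(2) r(1)] by blast
qed

end

section \<open>The game\<close>

text \<open>
  The comb whose leftmost branch \<open>map fst ps\<close> has \<open>snd (ps ! j)\<close> siblings to the right at
  level \<open>j + 1\<close>.
\<close>

fun stem :: "(nat \<times> nat) list \<Rightarrow> node set" where
  "stem [] = {[]}"
| "stem ((k, r) # ps) = insert [] ((\<lambda>i. [i]) ` {k..k + r} \<union> (#) k ` stem ps)"

lemma Nil_in_stem [simp]: "[] \<in> stem ps"
  by (cases ps rule: stem.cases) auto

lemma finite_stem [simp]: "finite (stem ps)"
  by (induction ps rule: stem.induct) auto

lemma length_stem: "\<sigma> \<in> stem ps \<Longrightarrow> length \<sigma> \<le> length ps"
  by (induction ps arbitrary: \<sigma> rule: stem.induct) auto

lemma height_stem: "height (stem ps) \<le> length ps"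
  using height_le[OF finite_stem, of ps "length ps"] length_stem Nil_in_stem by blast

lemma prefix_in_stem: "prefix \<tau> (map fst ps) \<Longrightarrow> \<tau> \<in> stem ps"
  by (induction ps arbitrary: \<tau> rule: stem.induct) (auto simp: prefix_Cons)

text \<open>The second alternative covers nodes that precede the branch lexicographically but are
  not leaves.\<close>

lemma stem_lexordp_eq: "\<sigma> \<in> stem ps \<Longrightarrow> lexordp_eq (map fst ps) \<sigma> \<or> strict_prefix \<sigma> (map fst ps)"
proof (induction ps arbitrary: \<sigma> rule: stem.induct)
  case (2 k r ps)
  then consider "\<sigma> = []" | i where "\<sigma> = [i]" "k \<le> i" | \<tau> where "\<sigma> = k # \<tau>" "\<tau> \<in> stem ps" by auto
  then show ?case
  proof cases
    case (2 i)
    then show ?thesis by (cases "i = k"; cases ps) (auto simp: lexordp_eq_refl)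
  next
    case (3 \<tau>)
    then show ?thesis using "2.IH" by auto
  qed auto
qed (simp add: lexordp_eq_refl)

lemma leftmost_leaf_stem [simp]: "leftmost_leaf (stem ps) = map fst ps"
proof (rule leftmost_leaf_eqI)
  have "map fst ps @ [i] \<notin> stem ps" for i using length_stem[of "map fst ps @ [i]" ps] by auto
  then show "leaf (stem ps) (map fst ps)" by (auto simp: leaf_def intro: prefix_in_stem)
  fix \<tau> assume \<tau>: "leaf (stem ps) \<tau>"
  have "\<not> strict_prefix \<tau> (map fst ps)"
  proof
    assume "strict_prefix \<tau> (map fst ps)"
    then obtain k \<sigma> where "map fst ps = \<tau> @ k # \<sigma>" by (elim strict_prefixE')
    then have "\<tau> @ [k] \<in> stem ps" by (intro prefix_in_stem) simp
    then show False using \<tau> by (simp add: leaf_def)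
  qed
  then show "lexordp_eq (map fst ps) \<tau>" using \<tau> stem_lexordp_eq by (auto simp: leaf_def)
qed

text \<open>The move creates \<open>b + 1\<close> children: child 0 prolongs the branch and the
  other \<open>b\<close> are its siblings.\<close>

lemma stem_extend: "stem (ps @ [(0, b)]) = stem ps \<union> {map fst ps @ [i] | i. i \<le> b}"
  by (induction ps rule: stem.induct) (auto simp: image_iff)

lemma stem_next: "0 < r \<Longrightarrow> map fst qs @ [Suc k] \<in> stem (qs @ (k, r) # us)"
  by (induction qs) auto

text \<open>Siblings to the right of the branch are leaves, so deleting the subtree at
  \<open>k\<close> discards all of \<open>us\<close> and the new branch ends at
  \<open>Suc k\<close>.\<close>

lemma stem_backtrack:
  "0 < r \<Longrightarrow> stem (qs @ (k, r) # us) - {map fst qs @ [k] @ \<tau> | \<tau>. True} =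
     stem (qs @ [(Suc k, r - 1)])"
proof (induction qs rule: stem.induct)
  case 1
  then show ?case by auto
next
  case (2 k' r' qs)
  have "{map fst ((k', r') # qs) @ [k] @ \<tau> | \<tau>. True} = (#) k' ` {map fst qs @ [k] @ \<tau> | \<tau>. True}"
    by auto
  moreover have "[i] \<notin> (#) k' ` {map fst qs @ [k] @ \<tau> | \<tau>. True}" for i by auto
  ultimately show ?case using 2 by (auto simp: image_iff)
qed

text \<open>The sibling counts \<open>rs\<close> still suffice for all descents from an element with code \<open>v\<close>.\<close>

fun fits :: "nat list \<Rightarrow> nat list \<Rightarrow> bool" where
  "fits v [] = True"
| "fits [] (r # rs) = False"
| "fits (a # v) (r # rs) = (a < r \<or> a = r \<and> fits v rs)"

text \<open>Compare \<open>w\<close> with \<open>rs\<close>. At the first entry below its count,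
  reducing that count by one still covers \<open>w\<close>. Without such an entry \<open>w\<close>
  and \<open>v\<close> both begin with \<open>rs\<close>, so the strict descent happens further on
  and the next entry of \<open>w\<close> can be appended.\<close>

lemma fits_step:
  assumes "ord_class.lexordp w v" "length w = length v" "fits v rs" "length rs \<le> length v"
  shows "(\<exists>qs r us. rs = qs @ r # us \<and> 0 < r \<and> fits w (qs @ [r - 1])) \<or>
    (length rs < length v \<and> (\<exists>b. fits w (rs @ [b])))"
  using assms
proof (induction rs arbitrary: v w)
  case Nil
  then obtain a u where "w = a # u" by (cases w; cases v) auto
  then have "fits w ([] @ [a])" by simp
  then show ?case using Nil by (cases v) auto
next
  case (Cons r rs)
  obtain a u b x where vw: "v = a # u" "w = b # x" using Cons.prems by (cases v; cases w) auto
  show ?case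
  proof (cases "b < r")
    case True
    then have "0 < r" "fits w ([] @ [r - 1])" using vw by auto
    then show ?thesis by (metis append_Nil)
  next
    case False
    then have eq: "a = r" "b = r" "ord_class.lexordp x u" "fits u rs"
      using Cons.prems vw by auto
    then consider qs r' us where "rs = qs @ r' # us" "0 < r'" "fits x (qs @ [r' - 1])"
      | c where "length rs < length u" "fits x (rs @ [c])"
      using Cons.IH[of x u] Cons.prems vw by auto
    then show ?thesis
    proof cases
      case 1
      then have "r # rs = (r # qs) @ r' # us" "fits w ((r # qs) @ [r' - 1])" using vw eq by auto
      then show ?thesis using 1(2) by blast
    next
      case 2
      then have "length (r # rs) < length v" "fits w ((r # rs) @ [c])" using vw eq by auto
      then show ?thesis by blast
    qed
  qed
qed

section \<open>Legal moves and histories\<close>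

lemma legal_StartE: "legal prec Start m \<Longrightarrow> (\<And>x. m = Choose x \<Longrightarrow> P) \<Longrightarrow> P"
  by (cases m) auto

lemma legal_QueriedE:
  "legal prec (Queried T \<rho> Q) m \<Longrightarrow>
    (\<And>\<rho>'. m = Reply \<rho>' \<Longrightarrow> Q \<subseteq> dom \<rho>' \<Longrightarrow>
      \<forall>q\<in>Q. \<rho>' q = Some True \<longrightarrow> (\<exists>p. prec p q \<and> \<rho>' p = Some True) \<Longrightarrow> P) \<Longrightarrow> P"
  by (cases m) auto

lemma state_after_snoc [simp]: "state_after h (ms @ [m]) = next_state h (state_after h ms) m"
  by (simp add: state_after_def)

lemma legal_history_snoc:
  "legal_history prec h ms \<Longrightarrow> legal prec (state_after h ms) m \<Longrightarrow> legal_history prec h (ms @ [m])"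
  by (auto simp: legal_history_def nth_append less_Suc_eq)

lemma legal_history_play:
  assumes "prover_strategy prec h S" "delayer_strategy prec h D"
  shows "legal_history prec h (play h S D n)"
proof (induction n)
  case 0
  show ?case by (simp add: legal_history_def)
next
  case (Suc n)
  then show ?case
    using assms legal_history_snoc by (auto simp: Let_def prover_strategy_def delayer_strategy_def)
qed

section \<open>Prover's invariant and winning strategy\<close>

context nat_wellorder
begin

definition least_one :: "partial_predicate \<Rightarrow> nat" where
  "least_one \<rho> = wo.Least (\<lambda>x. \<rho> x = Some True)"

lemma least_one: "\<rho> x = Some True \<Longrightarrow> \<rho> (least_one \<rho>) = Some True \<and> least_one \<rho> \<preceq> x"
  unfolding least_one_def
  using wo.LeastI[of "\<lambda>x. \<rho> x = Some True" x] wo.Least_le[of "\<lambda>x. \<rho> x = Some True" x] by blast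

text \<open>After a reply the counts still fit the code of some larger \<open>m\<close>, in play the
  previous least one. This strict descent is what Prover's next move draws on.\<close>

fun favourable :: "(nat \<Rightarrow> nat list) \<Rightarrow> nat \<Rightarrow> state \<Rightarrow> bool" where
  "favourable f h (At T \<rho>) \<longleftrightarrow> (\<exists>x. \<rho> x = Some True) \<and>
     (\<exists>ps. T = stem ps \<and> length ps \<le> h \<and> fits (f (least_one \<rho>)) (map snd ps))"
| "favourable f h (Queried T \<rho> Q) \<longleftrightarrow> Q = {least_one \<rho>} \<and> (\<exists>x. \<rho> x = Some True) \<and>
     (\<exists>ps. T = stem ps \<and> length ps \<le> h \<and> fits (f (least_one \<rho>)) (map snd ps))"
| "favourable f h (Replied T \<rho>) \<longleftrightarrow> (\<exists>x. \<rho> x = Some True) \<and>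
     (\<exists>ps m. T = stem ps \<and> length ps \<le> h \<and> fits (f m) (map snd ps) \<and> least_one \<rho> \<prec> m)"
| "favourable f h s \<longleftrightarrow> s = Prover_Wins"

text \<open>The queried number already has value 1, so a compatible reply must repeat it and hence
  name a smaller one.\<close>

lemma favourable_reply:
  assumes "favourable f h (Queried T \<rho> Q)" "legal (\<prec>) (Queried T \<rho> Q) m"
  shows "next_state h (Queried T \<rho> Q) m = Prover_Wins \<or>
    (\<exists>\<rho>'. next_state h (Queried T \<rho> Q) m = Replied T \<rho>' \<and> favourable f h (Replied T \<rho>') \<and>
       least_one \<rho>' \<prec> least_one \<rho>)"
proof -
  obtain \<rho>' where m: "m = Reply \<rho>'" "Q \<subseteq> dom \<rho>'"
    "\<forall>q\<in>Q. \<rho>' q = Some True \<longrightarrow> (\<exists>p. p \<prec> q \<and> \<rho>' p = Some True)"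
    using assms(2) by (rule legal_QueriedE)
  have Q: "Q = {least_one \<rho>}" "\<rho> (least_one \<rho>) = Some True" using assms(1) least_one by auto
  show ?thesis
  proof (cases "compatible \<rho> \<rho>'")
    case True
    then have "\<rho>' (least_one \<rho>) = Some True"
      using Q m(2) unfolding compatible_def by (metis IntI domI insert_subset)
    then obtain p where p: "p \<prec> least_one \<rho>" "\<rho>' p = Some True" using m(3) Q(1) by blast
    then have one: "(\<rho> ++ \<rho>') p = Some True" by simp
    have "least_one (\<rho> ++ \<rho>') \<preceq> p" using least_one[of "\<rho> ++ \<rho>'" p] one by blast
    then have "least_one (\<rho> ++ \<rho>') \<prec> least_one \<rho>" using p(1) by (rule wo.le_less_trans)
    moreover have "\<exists>x. (\<rho> ++ \<rho>') x = Some True" using one by (rule exI)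
    ultimately have "favourable f h (Replied T (\<rho> ++ \<rho>')) \<and> least_one (\<rho> ++ \<rho>') \<prec> least_one \<rho>"
      using assms(1) unfolding favourable.simps by blast
    then show ?thesis using True m(1) by simp
  qed (simp add: m(1))
qed

text \<open>The two outcomes of \<open>fits_step\<close> are the two moves: lowering a count is a
  backtrack, appending one is an extension within height \<open>h\<close>.\<close>

lemma favourable_replied:
  assumes f: "\<And>x. length (f x) = h" "\<And>x y. x \<prec> y \<Longrightarrow> ord_class.lexordp (f x) (f y)"
    and fav: "favourable f h (Replied T \<rho>)"
  shows "\<exists>m T'. legal (\<prec>) (Replied T \<rho>) m \<and> next_state h (Replied T \<rho>) m = At T' \<rho> \<and>
    favourable f h (At T' \<rho>)"
proof -
  obtain ps m where ps: "T = stem ps" "length ps \<le> h" "fits (f m) (map snd ps)" "least_one \<rho> \<prec> m"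
    and one: "\<exists>x. \<rho> x = Some True"
    using fav by auto
  let ?w = "f (least_one \<rho>)"
  have "(\<exists>qs r us. map snd ps = qs @ r # us \<and> 0 < r \<and> fits ?w (qs @ [r - 1])) \<or>
    (length (map snd ps) < length (f m) \<and> (\<exists>b. fits ?w (map snd ps @ [b])))"
    by (rule fits_step[OF f(2)[OF ps(4)]]) (use f(1) ps in auto)
  then consider qs r us where "map snd ps = qs @ r # us" "0 < r" "fits ?w (qs @ [r - 1])"
    | b where "length ps < h" "fits ?w (map snd ps @ [b])"
    using f(1) by auto
  then show ?thesis
  proof cases
    case 1
    then obtain qs' k us' where ps': "ps = qs' @ (k, r) # us'" "map snd qs' = qs"
      by (auto simp: map_eq_append_conv map_eq_Cons_conv)
    let ?ps = "qs' @ [(Suc k, r - 1)]"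
    have T: "leftmost_leaf T = map fst qs' @ k # map fst us'" using ps(1) ps'(1) by simp
    have "legal (\<prec>) (Replied T \<rho>) (Backtrack (map fst qs'))"
      by (simp add: T strict_prefix_def)
    moreover have "next_state h (Replied T \<rho>) (Backtrack (map fst qs')) = At (stem ?ps) \<rho>"
      using stem_next[OF 1(2), of qs' k us'] stem_backtrack[OF 1(2), of qs' k us'] ps(1) ps'(1)
      by (simp add: T nth_append Let_def)
    moreover have "favourable f h (At (stem ?ps) \<rho>)"
      using one 1(3) ps(2) ps' by (auto intro!: exI[of _ ?ps])
    ultimately show ?thesis by blast
  next
    case 2
    let ?ps = "ps @ [(0, b)]"
    have "next_state h (Replied T \<rho>) (Extend b) = At (stem ?ps) \<rho>"
      using height_stem[of ?ps] 2(1) by (simp add: ps(1) stem_extend Let_def)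
    moreover have "favourable f h (At (stem ?ps) \<rho>)"
      using one 2 by (auto intro!: exI[of _ ?ps])
    ultimately show ?thesis by (intro exI[of _ "Extend b"]) auto
  qed
qed

theorem ex_winning_strategy:
  fixes f :: "nat \<Rightarrow> nat list"
  assumes f: "\<And>x. length (f x) = h" "\<And>x y. x \<prec> y \<Longrightarrow> ord_class.lexordp (f x) (f y)"
  shows "\<exists>S. prover_winning_strategy (\<prec>) h S"
proof -
  \<comment> \<open>A strategy has to be legal after every legal history, so legality is
    unconditional; favourability only has to be kept once it holds.\<close>
  define good where "good s m \<longleftrightarrow> legal (\<prec>) s m \<and> (favourable f h s \<longrightarrow> favourable f h (next_state h s m))"
    for s m
  define S where "S ms = (SOME m. good (state_after h ms) m)" for ms
  have "\<exists>m. good s m" if "prover_to_move s" for s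
  proof (cases s)
    case (At T \<rho>)
    then have "good s (Query {least_one \<rho>})" by (simp add: good_def)
    then show ?thesis by (rule exI)
  next
    case (Replied T \<rho>)
    show ?thesis
    proof (cases "favourable f h s")
      case True
      then obtain m T' where m: "legal (\<prec>) s m" "next_state h s m = At T' \<rho>" "favourable f h (At T' \<rho>)"
        using favourable_replied[where f = f and T = T and \<rho> = \<rho>, OF f] unfolding Replied by blast
      have "good s m" unfolding good_def m(2) using m by blast
      then show ?thesis by (rule exI)
    next
      case False
      moreover have "legal (\<prec>) s (Extend 0)" using Replied by simp
      ultimately have "good s (Extend 0)" unfolding good_def by blast
      then show ?thesis by (rule exI)
    qed
  qed (use that in auto)
  then have S: "good (state_after h ms) (S ms)" if "prover_to_move (state_after h ms)" for ms
    using that unfolding S_def by (metis someI_ex)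
  then have PS: "prover_strategy (\<prec>) h S" by (auto simp: prover_strategy_def good_def)
  moreover have "\<exists>n. state_after h (play h S D n) = Prover_Wins" if D: "delayer_strategy (\<prec>) h D" for D
  proof -
    let ?s = "\<lambda>n. state_after h (play h S D n)"
    have prover: "?s (Suc n) = next_state h (?s n) (S (play h S D n)) \<and> good (?s n) (S (play h S D n))"
      if "prover_to_move (?s n)" for n
      using that S by (simp add: Let_def)
    have delayer: "?s (Suc n) = next_state h (?s n) (D (play h S D n)) \<and> legal (\<prec>) (?s n) (D (play h S D n))"
      if "delayer_to_move (?s n)" for n
    proof -
      have "\<not> prover_to_move (?s n)" using that by (cases "?s n") auto
      then show ?thesis
        using that D legal_history_play[OF PS D] by (simp add: Let_def delayer_strategy_def)
    qed
    have "\<exists>n. ?s n = Prover_Wins" if "?s n = At T \<rho>" "favourable f h (At T \<rho>)" for n T \<rho>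
      using that
    \<comment> \<open>Each full round strictly lowers the least one, so well-foundedness ends the
      play.\<close>
    proof (induction "least_one \<rho>" arbitrary: n T \<rho> rule: wo.less_induct)
      case less
      have "good (At T \<rho>) (S (play h S D n))" and s1: "?s (Suc n) = next_state h (At T \<rho>) (S (play h S D n))"
        using prover[of n] less.prems(1) by auto
      moreover from this obtain Q where Q: "S (play h S D n) = Query Q"
        unfolding good_def by (cases "S (play h S D n)") auto
      ultimately have s1: "?s (Suc n) = Queried T \<rho> Q" and fav: "favourable f h (Queried T \<rho> Q)"
        using less.prems(2) by (auto simp: good_def)
      have "?s (Suc (Suc n)) = Prover_Wins \<or> (\<exists>\<rho>'. ?s (Suc (Suc n)) = Replied T \<rho>' \<and>
          favourable f h (Replied T \<rho>') \<and> least_one \<rho>' \<prec> least_one \<rho>)"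
        using delayer[of "Suc n"] favourable_reply[OF fav] unfolding s1 by auto
      then show ?case
      proof
        assume "\<exists>\<rho>'. ?s (Suc (Suc n)) = Replied T \<rho>' \<and>
          favourable f h (Replied T \<rho>') \<and> least_one \<rho>' \<prec> least_one \<rho>"
        then obtain \<rho>' where s2: "?s (Suc (Suc n)) = Replied T \<rho>'"
          "favourable f h (Replied T \<rho>')" "least_one \<rho>' \<prec> least_one \<rho>" by blast
        let ?m = "S (play h S D (Suc (Suc n)))"
        have "?s (Suc (Suc (Suc n))) = next_state h (Replied T \<rho>') ?m" "good (Replied T \<rho>') ?m"
          using prover[of "Suc (Suc n)"] unfolding s2(1) by auto
        then have fav3: "favourable f h (?s (Suc (Suc (Suc n))))"
          and s3: "?s (Suc (Suc (Suc n))) = next_state h (Replied T \<rho>') ?m" "legal (\<prec>) (Replied T \<rho>') ?m"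
          using s2(2) unfolding good_def by metis+
        \<comment> \<open>The move is an extension or a backtrack; a loss is then ruled out because
          \<open>Delayer_Wins\<close> is not favourable.\<close>
        have "\<exists>T'. next_state h (Replied T \<rho>') ?m = At T' \<rho>' \<or> next_state h (Replied T \<rho>') ?m = Delayer_Wins"
          using s3(2) by (cases ?m) (auto simp: Let_def)
        then obtain T' where "?s (Suc (Suc (Suc n))) = At T' \<rho>'" using fav3 s3(1) by auto
        then show ?case using less.hyps[OF s2(3)] fav3 by metis
      qed blast
    qed
    moreover have "\<exists>T \<rho>. ?s (Suc 0) = At T \<rho> \<and> favourable f h (At T \<rho>)"
    proof -
      have s0: "?s 0 = Start" by (simp add: state_after_def)
      obtain x where x: "?s (Suc 0) = next_state h Start (Choose x)"
        using delayer[of 0] unfolding s0 by (metis delayer_to_move.simps(1) legal_StartE)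
      \<comment> \<open>There are no counts yet, and the empty list fits every code.\<close>
      have "favourable f h (At {[]} [x \<mapsto> True])" by (auto intro!: exI[of _ "[]"])
      then show ?thesis using x by simp
    qed
    ultimately show ?thesis by blast
  qed
  ultimately show ?thesis by (auto simp: prover_winning_strategy_def)
qed

end

theorem theorem3p16:
  fixes prec :: "nat \<Rightarrow> nat \<Rightarrow> bool"
  assumes "wfp prec" and "transp prec" and "totalp prec"
    and "provable (ISigma_X 1) (TI prec)"
  shows "\<exists>h S. prover_winning_strategy prec h S"
proof -
  interpret nat_wellorder prec using assms(1-3) by unfold_locales
  \<comment> \<open>The exponent that bounds all distances becomes the length of the codes and thus
    the height of the game.\<close>
  obtain h where "\<And>x y. \<not> far h x y" using TI_not_provable assms(4) by blast
  then obtain f :: "nat \<Rightarrow> nat list" where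
    f: "\<And>x. length (f x) = h" "\<And>x y. prec x y \<Longrightarrow> ord_class.lexordp (f x) (f y)"
    using ex_lex_embedding by metis
  show ?thesis using ex_winning_strategy[of f h, OF f] by blast
qed

end
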